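(* Let $F$ be a field with $\operatorname{char}(F)\neq 2,3$, let $K/F$ be a quadratic étale extension with non-trivial Galois automorphism $\sigma$, let $\mathcal{J}=(J,N,\sharp,T,1)$ be a cubic norm structure over $K$, and let $\varphi\in\operatorname{Str}(\mathcal{J})$ be a $\sigma$-semilinear self-adjoint autotopy of $\mathcal{J}$. Let $\delta:=N(\varphi(1))$, and assume that there is an element $\gamma\in K$ such that $\gamma^{\sigma+1}=\delta^{-1}$; in particular, $\delta\in F$. Let $\mathcal{A}=K\oplus J$ as an $F$-vector space, equipped with the involution $\overline{(s,b)}:=(s^\sigma,b)$ for all $s\in K$, $b\in J$, and with multiplication $$(s,b)(t,c):=\bigl(st+T(b,\varphi(c)),\; sc+t^\sigma b+\gamma\,(\varphi(b)\times\varphi(c))\bigr)$$ for all $s,t\in K$ and all $b,c\in J$. Then $\mathcal{A}$ is a structurable $F$-algebra of skew-dimension one. Moreover, if $T$ is non-degenerate, then $\mathcal{A}$ is a central simple structurable $F$-algebra.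
   Context: **Conventions.** A quadratic étale extension $K/F$ is either a separable quadratic field extension or the split algebra $F\oplus F$ (with $\sigma$ the exchange map). For $t\in K$ write $t^\sigma=\sigma(t)$ and $t^{\sigma+1}=t^\sigma t$. $T$ is non-degenerate if $T(a,J)=0$ implies $a=0$. **Cubic norm structure.** A cubic norm structure over a commutative associative $F$-algebra $K$ is a quintuple $\mathcal{J}=(J,N,\sharp,T,1)$, where $J$ is a left $K$-module, $N\colon J\to K$, $\sharp\colon J\to J$, $a\mapsto a^\sharp$, are maps, $T\colon J\times J\to K$ is a symmetric $K$-bilinear form and $1\in J\setminus\{0\}$, such that with $a\times b:=(a+b)^\sharp-a^\sharp-b^\sharp$, for all $t\in K$, $a,b\in J$: (i) $(ta)^\sharp=t^2a^\sharp$; (ii) $N(ta)=t^3N(a)$; (iii) $N(a+b)=N(a)+T(b,a^\sharp)+T(a,b^\sharp)+N(b)$; (iv) $a^{\sharp\sharp}=N(a)a$; (v) $1^\sharp=1$; (vi) $b=T(b,1)1-1\times b$. Put $U_a(b):=T(a,b)a-a^\sharp\times b$. An element $a\in J$ is invertible if $N(a)$ is invertible in $K$. **Autotopies.** For invertible $z\in J$, put $a^{\sharp_z}:=N(z)^{-1}U_z(a^\sharp)$. A map $\varphi\colon J\to J$ is $\sigma$-semilinear if it is additive and $\varphi(ta)=t^\sigma\varphi(a)$ for all $t\in K$, $a\in J$. A $\sigma$-semilinear bijection $\varphi\colon J\to J$ such that $z:=\varphi(1)$ is invertible is an autotopy of $\mathcal{J}$ if $\varphi(a^\sharp)=\varphi(a)^{\sharp_z}$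 for all $a\in J$. $\operatorname{Str}(\mathcal{J})$ is the group of all autotopies (over all $\sigma\in\operatorname{Aut}(K)$). The adjoint of $\varphi$ is $\check\varphi:=\varphi^{-1}U_z$, and $\varphi$ is self-adjoint if $\check\varphi=\varphi$. **Structurable algebra.** A structurable algebra over $F$ is a unital, not necessarily commutative or associative, $F$-algebra $\mathcal{A}$ with an $F$-linear involution $x\mapsto\overline{x}$ (so $\overline{\overline{x}}=x$, $\overline{xy}=\overline{y}\,\overline{x}$) such that, with $V_{x,y}(z):=(x\overline{y})z+(z\overline{y})x-(z\overline{x})y$, one has $[V_{x,y},V_{z,w}]=V_{V_{x,y}(z),w}-V_{z,V_{y,x}(w)}$ for all $x,y,z,w\in\mathcal{A}$, where $[A,B]=AB-BA$. Let $\mathcal{H}=\{x:\overline{x}=x\}$ and $\mathcal{S}=\{x:\overline{x}=-x\}$; the skew-dimension is $\dim_F\mathcal{S}$. With $[x,y]=xy-yx$ and $[x,y,z]=(xy)z-x(yz)$, the center is $Z(\mathcal{A})=\{x\in\mathcal{H}\mid [x,\mathcal{A}]=[x,\mathcal{A},\mathcal{A}]=[\mathcal{A},x,\mathcal{A}]=[\mathcal{A},\mathcal{A},x]=0\}$; $\mathcal{A}$ is central if $Z(\mathcal{A})=F\cdot 1$. An ideal is an $F$-subspace $I$ with $I\mathcal{A}\subseteq I$, $\mathcal{A}I\subseteq I$, $\overline{I}=I$; $\mathcal{A}$ is simple if it has no proper non-trivial ideals.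
   Formalization: The first claim (structurable of skew-dimension one) is proved assuming that ♯ is a quadratic map (× is K-bilinear) or T is non-degenerate; axioms (i)–(vi) alone do not force × to be biadditive, and without that 𝒜 is not an F-algebra. *)

theory Defs
  imports
    "HOL-Computational_Algebra.Computational_Algebra"
    "HOL-Library.Product_Plus"
begin

section \<open>Quadratic etale extensions\<close>

definition unit_inverse :: "'k::comm_ring_1 \<Rightarrow> 'k" where
  "unit_inverse x = (THE y. x * y = 1)"

definition ring_automorphism :: "('k::comm_ring_1 \<Rightarrow> 'k) \<Rightarrow> bool" where
  "ring_automorphism \<sigma> \<longleftrightarrow> bij \<sigma> \<and> \<sigma> 1 = 1 \<and>
     (\<forall>x y. \<sigma> (x + y) = \<sigma> x + \<sigma> y) \<and> (\<forall>x y. \<sigma> (x * y) = \<sigma> x * \<sigma> y)"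

text \<open>
  A commutative \<open>F\<close>-algebra \<open>K\<close> is given by its structure map \<open>\<iota> :: 'f \<Rightarrow> 'k\<close>,
  and \<open>F\<close> is identified with \<open>range \<iota>\<close>.
\<close>

definition algebra_map :: "('f::field \<Rightarrow> 'k::comm_ring_1) \<Rightarrow> bool" where
  "algebra_map \<iota> \<longleftrightarrow> \<iota> 1 = 1 \<and>
     (\<forall>x y. \<iota> (x + y) = \<iota> x + \<iota> y) \<and> (\<forall>x y. \<iota> (x * y) = \<iota> x * \<iota> y)"

text \<open>
  An algebraic element is separable (its minimal polynomial is separable) iff it is a root of some
  polynomial that is coprime to its derivative; this also excludes the zero polynomial.
\<close>

definition separable_quadratic_field :: "('f::field \<Rightarrow> 'k::comm_ring_1) \<Rightarrow> bool" where
  "separable_quadratic_field \<iota> \<longleftrightarrow>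
     (\<forall>x::'k. x \<noteq> 0 \<longrightarrow> x dvd 1) \<and>
     vector_space.dim (\<lambda>c x. \<iota> c * x) (UNIV :: 'k set) = 2 \<and>
     (\<forall>x::'k. \<exists>p::'f poly. coprime p (pderiv p) \<and> poly (map_poly \<iota> p) x = 0)"

definition split_algebra_iso ::
    "('f::field \<Rightarrow> 'k::comm_ring_1) \<Rightarrow> ('k \<Rightarrow> 'f \<times> 'f) \<Rightarrow> bool" where
  "split_algebra_iso \<iota> h \<longleftrightarrow> bij h \<and>
     (\<forall>c. h (\<iota> c) = (c, c)) \<and>
     (\<forall>x y. h (x + y) = h x + h y) \<and>
     (\<forall>x y. h (x * y) = (fst (h x) * fst (h y), snd (h x) * snd (h y)))"

locale quadratic_etale_extension =
  fixes \<iota> :: "'f::field \<Rightarrow> 'k::comm_ring_1" and \<sigma> :: "'k \<Rightarrow> 'k"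
  assumes algebra_map: "algebra_map \<iota>"
    and automorphism: "ring_automorphism \<sigma>"
    and fixes_base: "\<sigma> (\<iota> c) = \<iota> c"
    and field_or_split:
      "(separable_quadratic_field \<iota> \<and> \<sigma> \<noteq> id) \<or>
       (\<exists>h. split_algebra_iso \<iota> h \<and> (\<forall>x. h (\<sigma> x) = prod.swap (h x)))"

section \<open>Cubic norm structures and their autotopies\<close>

definition cross :: "('j::ab_group_add \<Rightarrow> 'j) \<Rightarrow> 'j \<Rightarrow> 'j \<Rightarrow> 'j" where
  "cross sharp a b = sharp (a + b) - sharp a - sharp b"

locale cubic_norm_structure = module smul
  for smul :: "'k::comm_ring_1 \<Rightarrow> 'j::ab_group_add \<Rightarrow> 'j" +
  fixes N :: "'j \<Rightarrow> 'k" and sharp :: "'j \<Rightarrow> 'j" and T :: "'j \<Rightarrow> 'j \<Rightarrow> 'k" and e :: 'j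
  assumes T_sym: "T a b = T b a"
    and T_linear: "module_hom smul (*) (T a)"
    and unit_nonzero: "e \<noteq> 0"
    and sharp_smul: "sharp (smul t a) = smul (t ^ 2) (sharp a)"
    and N_smul: "N (smul t a) = t ^ 3 * N a"
    and N_add: "N (a + b) = N a + T b (sharp a) + T a (sharp b) + N b"
    and sharp_sharp: "sharp (sharp a) = smul (N a) a"
    and sharp_unit: "sharp e = e"
    and unit_cross: "b = smul (T b e) e - cross sharp e b"

text \<open>
  The axioms above do not force \<open>sharp\<close> to be a quadratic map, i.e. \<open>\<times>\<close> to be \<open>K\<close>-bilinear.
  It is when \<open>T\<close> is non-degenerate, because \<open>T c (a \<times> b)\<close> is symmetric in \<open>a, b, c\<close> by \<open>N_add\<close>.
  It need not be otherwise: on \<open>J = K\<^sup>4\<close> with \<open>e = (1,0,0,0)\<close> put \<open>N (s,x,y,w) = s\<^sup>3\<close>,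
  \<open>T (s,x,y,w) (s',x',y',w') = 3 s s'\<close> and
  \<open>sharp (s,x,y,w) = (s\<^sup>2, -s x, -s y, f x y - s w)\<close>, where \<open>f\<close> is any map with
  \<open>f (t x) (t y) = t\<^sup>2 f x y\<close>, for instance \<open>f x y = x\<^sup>3/y\<close> with \<open>x/0 = 0\<close> over a field.
\<close>

definition quadratic_map ::
    "('k::comm_ring_1 \<Rightarrow> 'j::ab_group_add \<Rightarrow> 'j) \<Rightarrow> ('j \<Rightarrow> 'j) \<Rightarrow> bool" where
  "quadratic_map smul q \<longleftrightarrow>
     (\<forall>t a. q (smul t a) = smul (t ^ 2) (q a)) \<and> (\<forall>a. module_hom smul smul (cross q a))"

definition nondegenerate :: "('j::ab_group_add \<Rightarrow> 'j \<Rightarrow> 'k::comm_ring_1) \<Rightarrow> bool" where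
  "nondegenerate T \<longleftrightarrow> (\<forall>a. (\<forall>b. T a b = 0) \<longrightarrow> a = 0)"

definition U_op ::
    "('k::comm_ring_1 \<Rightarrow> 'j::ab_group_add \<Rightarrow> 'j) \<Rightarrow> ('j \<Rightarrow> 'j) \<Rightarrow> ('j \<Rightarrow> 'j \<Rightarrow> 'k) \<Rightarrow> 'j \<Rightarrow> 'j \<Rightarrow> 'j"
  where
  "U_op smul sharp T a b = smul (T a b) a - cross sharp (sharp a) b"

definition invertible :: "('j \<Rightarrow> 'k::comm_ring_1) \<Rightarrow> 'j \<Rightarrow> bool" where
  "invertible N a \<longleftrightarrow> N a dvd 1"

definition isotope_sharp ::
    "('k::comm_ring_1 \<Rightarrow> 'j::ab_group_add \<Rightarrow> 'j) \<Rightarrow> ('j \<Rightarrow> 'k) \<Rightarrow> ('j \<Rightarrow> 'j) \<Rightarrow> ('j \<Rightarrow> 'j \<Rightarrow> 'k) \<Rightarrow>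
      'j \<Rightarrow> 'j \<Rightarrow> 'j" where
  "isotope_sharp smul N sharp T z a = smul (unit_inverse (N z)) (U_op smul sharp T z (sharp a))"

definition semilinear ::
    "('k::comm_ring_1 \<Rightarrow> 'j::ab_group_add \<Rightarrow> 'j) \<Rightarrow> ('k \<Rightarrow> 'k) \<Rightarrow> ('j \<Rightarrow> 'j) \<Rightarrow> bool" where
  "semilinear smul \<sigma> \<phi> \<longleftrightarrow>
     (\<forall>a b. \<phi> (a + b) = \<phi> a + \<phi> b) \<and> (\<forall>t a. \<phi> (smul t a) = smul (\<sigma> t) (\<phi> a))"

definition Str ::
    "('k::comm_ring_1 \<Rightarrow> 'j::ab_group_add \<Rightarrow> 'j) \<Rightarrow> ('j \<Rightarrow> 'k) \<Rightarrow> ('j \<Rightarrow> 'j) \<Rightarrow> ('j \<Rightarrow> 'j \<Rightarrow> 'k) \<Rightarrow>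
      'j \<Rightarrow> ('j \<Rightarrow> 'j) set" where
  "Str smul N sharp T e =
     {\<phi>. (\<exists>\<sigma>. ring_automorphism \<sigma> \<and> semilinear smul \<sigma> \<phi>) \<and> bij \<phi> \<and> invertible N (\<phi> e) \<and>
         (\<forall>a. \<phi> (sharp a) = isotope_sharp smul N sharp T (\<phi> e) (\<phi> a))}"

definition adjoint ::
    "('k::comm_ring_1 \<Rightarrow> 'j::ab_group_add \<Rightarrow> 'j) \<Rightarrow> ('j \<Rightarrow> 'j) \<Rightarrow> ('j \<Rightarrow> 'j \<Rightarrow> 'k) \<Rightarrow> 'j \<Rightarrow>
      ('j \<Rightarrow> 'j) \<Rightarrow> ('j \<Rightarrow> 'j)" where
  "adjoint smul sharp T e \<phi> = inv \<phi> \<circ> U_op smul sharp T (\<phi> e)"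

definition self_adjoint ::
    "('k::comm_ring_1 \<Rightarrow> 'j::ab_group_add \<Rightarrow> 'j) \<Rightarrow> ('j \<Rightarrow> 'j) \<Rightarrow> ('j \<Rightarrow> 'j \<Rightarrow> 'k) \<Rightarrow> 'j \<Rightarrow>
      ('j \<Rightarrow> 'j) \<Rightarrow> bool" where
  "self_adjoint smul sharp T e \<phi> \<longleftrightarrow> adjoint smul sharp T e \<phi> = \<phi>"

section \<open>Structurable algebras\<close>

definition V_op ::
    "('a::ab_group_add \<Rightarrow> 'a \<Rightarrow> 'a) \<Rightarrow> ('a \<Rightarrow> 'a) \<Rightarrow> 'a \<Rightarrow> 'a \<Rightarrow> 'a \<Rightarrow> 'a" where
  "V_op mul invol x y z =
     mul (mul x (invol y)) z + mul (mul z (invol y)) x - mul (mul z (invol x)) y"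

locale structurable_algebra = vector_space scale
  for scale :: "'f::field \<Rightarrow> 'a::ab_group_add \<Rightarrow> 'a" +
  fixes mul :: "'a \<Rightarrow> 'a \<Rightarrow> 'a" and unit :: 'a and invol :: "'a \<Rightarrow> 'a"
  assumes mult_linear_right: "Vector_Spaces.linear scale scale (\<lambda>y. mul x y)"
    and mult_linear_left: "Vector_Spaces.linear scale scale (\<lambda>x. mul x y)"
    and mult_unit_left: "mul unit x = x"
    and mult_unit_right: "mul x unit = x"
    and invol_linear: "Vector_Spaces.linear scale scale invol"
    and invol_invol: "invol (invol x) = x"
    and invol_mult: "invol (mul x y) = mul (invol y) (invol x)"
    and V_commutator:
      "V_op mul invol x y (V_op mul invol z w u) - V_op mul invol z w (V_op mul invol x y u) =
       V_op mul invol (V_op mul invol x y z) w u - V_op mul invol z (V_op mul invol y x w) u"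

definition skew_dimension ::
    "('f::field \<Rightarrow> 'a::ab_group_add \<Rightarrow> 'a) \<Rightarrow> ('a \<Rightarrow> 'a) \<Rightarrow> nat" where
  "skew_dimension scale invol = vector_space.dim scale {x. invol x = - x}"

definition commutator :: "('a::ab_group_add \<Rightarrow> 'a \<Rightarrow> 'a) \<Rightarrow> 'a \<Rightarrow> 'a \<Rightarrow> 'a" where
  "commutator mul x y = mul x y - mul y x"

definition associator :: "('a::ab_group_add \<Rightarrow> 'a \<Rightarrow> 'a) \<Rightarrow> 'a \<Rightarrow> 'a \<Rightarrow> 'a \<Rightarrow> 'a" where
  "associator mul x y z = mul (mul x y) z - mul x (mul y z)"

definition center :: "('a::ab_group_add \<Rightarrow> 'a \<Rightarrow> 'a) \<Rightarrow> ('a \<Rightarrow> 'a) \<Rightarrow> 'a set" where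
  "center mul invol = {x. invol x = x \<and> (\<forall>y. commutator mul x y = 0) \<and>
     (\<forall>y z. associator mul x y z = 0 \<and> associator mul y x z = 0 \<and> associator mul y z x = 0)}"

definition central ::
    "('f::field \<Rightarrow> 'a::ab_group_add \<Rightarrow> 'a) \<Rightarrow> ('a \<Rightarrow> 'a \<Rightarrow> 'a) \<Rightarrow> 'a \<Rightarrow> ('a \<Rightarrow> 'a) \<Rightarrow> bool" where
  "central scale mul unit invol \<longleftrightarrow> center mul invol = range (\<lambda>c. scale c unit)"

definition involution_ideal ::
    "('f::field \<Rightarrow> 'a::ab_group_add \<Rightarrow> 'a) \<Rightarrow> ('a \<Rightarrow> 'a \<Rightarrow> 'a) \<Rightarrow> ('a \<Rightarrow> 'a) \<Rightarrow> 'a set \<Rightarrow> bool" where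
  "involution_ideal scale mul invol I \<longleftrightarrow> module.subspace scale I \<and>
     (\<forall>x\<in>I. \<forall>y. mul x y \<in> I \<and> mul y x \<in> I) \<and> invol ` I = I"

definition simple_algebra ::
    "('f::field \<Rightarrow> 'a::ab_group_add \<Rightarrow> 'a) \<Rightarrow> ('a \<Rightarrow> 'a \<Rightarrow> 'a) \<Rightarrow> ('a \<Rightarrow> 'a) \<Rightarrow> bool" where
  "simple_algebra scale mul invol \<longleftrightarrow>
     (\<forall>I. involution_ideal scale mul invol I \<longrightarrow> I = {0} \<or> I = UNIV)"

section \<open>The algebra \<open>K \<oplus> J\<close>\<close>

definition KJ_scale ::
    "('f::field \<Rightarrow> 'k::comm_ring_1) \<Rightarrow> ('k \<Rightarrow> 'j::ab_group_add \<Rightarrow> 'j) \<Rightarrow> 'f \<Rightarrow> 'k \<times> 'j \<Rightarrow> 'k \<times> 'j"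
  where
  "KJ_scale \<iota> smul c x = (\<iota> c * fst x, smul (\<iota> c) (snd x))"

definition KJ_invol :: "('k \<Rightarrow> 'k) \<Rightarrow> 'k \<times> 'j \<Rightarrow> 'k \<times> 'j" where
  "KJ_invol \<sigma> x = (\<sigma> (fst x), snd x)"

fun KJ_mult ::
    "('k::comm_ring_1 \<Rightarrow> 'j::ab_group_add \<Rightarrow> 'j) \<Rightarrow> ('j \<Rightarrow> 'j) \<Rightarrow> ('j \<Rightarrow> 'j \<Rightarrow> 'k) \<Rightarrow> ('k \<Rightarrow> 'k) \<Rightarrow>
      ('j \<Rightarrow> 'j) \<Rightarrow> 'k \<Rightarrow> 'k \<times> 'j \<Rightarrow> 'k \<times> 'j \<Rightarrow> 'k \<times> 'j" where
  "KJ_mult smul sharp T \<sigma> \<phi> \<gamma> (s, b) (t, c) =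
     (s * t + T b (\<phi> c),
      smul s c + smul (\<sigma> t) b + smul \<gamma> (cross sharp (\<phi> b) (\<phi> c)))"

end

theory Submission
  imports Defs
begin

text \<open>
  The multiplication of \<open>K \<oplus> J\<close> sees the cubic norm structure only through \<open>h b c = T b (\<phi> c)\<close> and
  \<open>b \<circ> c = \<gamma> (\<phi> b \<times> \<phi> c)\<close>. Since \<open>\<phi>\<close> is a self-adjoint \<open>\<sigma>\<close>-semilinear autotopy and
  \<open>\<gamma> \<sigma>(\<gamma>) N(\<phi> 1) = 1\<close>, the form \<open>h\<close> is \<open>\<sigma>\<close>-hermitian, \<open>\<circ>\<close> is commutative and \<open>\<sigma>\<close>-linear in both
  arguments, and \<open>h a (b \<circ> c)\<close> is a symmetric \<open>K\<close>-trilinear form. With \<open>adj b = \<gamma> (\<phi> b)\<^sup>\<sharp>\<close> and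
  \<open>n b = \<gamma>\<^sup>-\<^sup>1 N b\<close> the two basic identities of cubic norm structures become
    \<open>adj a \<circ> (a \<circ> c) = n(a) c + h(c, adj a) a\<close> and
    \<open>a \<circ> (adj a \<circ> c) = \<sigma>(n a) c + h(c, a) adj a\<close>.
  These laws form the locale \<open>hermitian_cubic_norm_structure\<close>, and all the rest follows from them.

  The identity that defines structurable algebras is linear in five variables. It is reduced to an
  identity in two variables by means of a Freudenthal triple system. The skew elements are the
  multiples \<open>F \<epsilon>\<close> of one unit \<open>\<epsilon>\<close> of \<open>K\<close>, so \<open>x \<cdot> bar y - y \<cdot> bar x\<close> is a multiple of \<open>\<epsilon>\<close>, and this
  defines a skew-symmetric form \<open>\<kappa>\<close> with values in \<open>F\<close>. Up to terms in \<open>\<kappa>\<close> the product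
  \<open>V x (2 \<epsilon> y) z\<close> is symmetric in \<open>x, y, z\<close>; call its symmetric part \<open>S x y z\<close>. The operator
  \<open>D x y = V x (2 \<epsilon> y) - \<kappa> y x\<close> is symmetric in \<open>x, y\<close>. If \<open>D (S x x x) x = 0\<close> for all \<open>x\<close>, then the
  linearizations of this quartic identity say that every \<open>D x y\<close> is a derivation of \<open>S\<close>
  (\<open>D_derivation_S\<close>), and this is exactly the identity for \<open>V\<close> (\<open>L_commutator\<close>).

  The quartic identity is verified in coordinates (\<open>S_quartic\<close>): for \<open>x = (s, b)\<close> one has
  \<open>S x x x = 6 \<epsilon> (A, B)\<close>, and it follows from three relations between \<open>A, B, s, b\<close>, the main one being
  \<open>A b + s B + B \<circ> b = 0\<close>.

  An element of the center commutes with the skew element \<open>(\<epsilon>, 0)\<close>, and this kills its component in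
  \<open>J\<close>. Left and right multiplication by \<open>(\<epsilon>, 0)\<close> agree on \<open>K\<close> and are opposite on \<open>J\<close>, so an ideal
  contains the \<open>K\<close>-components of its elements; non-degeneracy of \<open>T\<close> makes one of them nonzero, and
  then the involution produces a nonzero element of \<open>F\<close> in the ideal.
\<close>

section \<open>Polarization\<close>

text \<open>
  Symmetric multi-additive maps into a group without 2- and 3-torsion are determined by their
  values on the diagonal. Only additivity is used, so the lemmas serve for \<open>K\<close>-linear and
  \<open>\<sigma>\<close>-linear identities alike.
\<close>

lemma polarize2:
  fixes Q :: "'a::ab_group_add \<Rightarrow> 'a \<Rightarrow> 'b::ab_group_add"
  assumes two: "\<And>y::'b. y + y = 0 \<Longrightarrow> y = 0"
    and add: "\<And>x x' y. Q (x + x') y = Q x y + Q x' y"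
    and sym: "\<And>x y. Q x y = Q y x"
    and diag: "\<And>x. Q x x = 0"
  shows "Q x y = 0"
proof -
  have add2: "Q z (v + w) = Q z v + Q z w" for z v w
    using add[of v w z] sym by metis
  have "Q (x + y) (x + y) = Q x y + Q x y"
    by (simp only: add add2) (simp add: diag sym[of y x])
  then have "Q x y + Q x y = 0" by (simp only: diag)
  then show ?thesis by (rule two)
qed

lemma additive_minus:
  fixes f :: "'a::ab_group_add \<Rightarrow> 'b::ab_group_add"
  assumes "\<And>x y. f (x + y) = f x + f y"
  shows "f 0 = 0" "f (- x) = - f x" "f (x - y) = f x - f y"
proof -
  interpret additive f by standard (rule assms)
  show "f 0 = 0" "f (- x) = - f x" "f (x - y) = f x - f y"
    by (rule zero minus diff)+
qed

lemma polarize3: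
  fixes M :: "'a::ab_group_add \<Rightarrow> 'a \<Rightarrow> 'a \<Rightarrow> 'b::ab_group_add"
  assumes two: "\<And>y::'b. y + y = 0 \<Longrightarrow> y = 0"
    and three: "\<And>y::'b. y + y + y = 0 \<Longrightarrow> y = 0"
    and add: "\<And>x x' y z. M (x + x') y z = M x y z + M x' y z"
    and sym12: "\<And>x y z. M x y z = M y x z"
    and sym23: "\<And>x y z. M x y z = M x z y"
    and diag: "\<And>x. M x x x = 0"
  shows "M x y z = 0"
proof -
  have add2: "M w (x + x') z = M w x z + M w x' z" for w x x' z
    using add sym12 by metis
  have add3: "M w z (x + x') = M w z x + M w z x'" for w x x' z
    using add2 sym23 by metis
  note minus = additive_minus(2)[of "\<lambda>x. M x _ _", OF add]
      additive_minus(2)[of "\<lambda>x. M _ x _", OF add2]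
    additive_minus(2)[of "\<lambda>x. M _ _ x", OF add3]
  have D: "M x y y = 0" for x y
  proof -
    have yx: "M y x y = M x y y" "M y y x = M x y y" "M x y x = M x x y" "M y x x = M x x y"
      by (simp_all add: sym12 sym23)
    have p: "M (x + y) (x + y) (x + y) = (M x x y + M x x y + M x x y) + (M x y y + M x y y + M x
        y y)"
      by (simp only: add add2 add3) (simp add: diag yx)
    have m: "M (x + - y) (x + - y) (x + - y) = - (M x x y + M x x y + M x x y) + (M x y y + M x y
        y + M x y y)"
      by (simp only: add add2 add3 minus) (simp add: diag yx)
    let ?w = "M x y y + M x y y + M x y y"
    have "?w + ?w = M (x + y) (x + y) (x + y) + M (x + - y) (x + - y) (x + - y)"
      unfolding p m by (simp add: algebra_simps)
    then have "?w + ?w = 0" by (simp only: diag) simp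
    then have "?w = 0" by (rule two)
    then show ?thesis by (rule three)
  qed
  show ?thesis
    by (rule polarize2[where Q = "M x"], erule two) (rule add2, rule sym23, rule D)
qed

text \<open>
  Comparing \<open>x + y\<close> with \<open>x - y\<close> isolates the part of bidegree \<open>(2, 2)\<close>, which is then polarized
  separately in \<open>x\<close> and in \<open>y\<close>; the parts of bidegree \<open>(3, 1)\<close> and \<open>(1, 3)\<close> never have to be separated.
\<close>

lemma polarize4:
  fixes M :: "'a::ab_group_add \<Rightarrow> 'a \<Rightarrow> 'a \<Rightarrow> 'a \<Rightarrow> 'b::ab_group_add"
  assumes two: "\<And>y::'b. y + y = 0 \<Longrightarrow> y = 0"
    and three: "\<And>y::'b. y + y + y = 0 \<Longrightarrow> y = 0"
    and add: "\<And>x x' y z w. M (x + x') y z w = M x y z w + M x' y z w"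
    and sym12: "\<And>x y z w. M x y z w = M y x z w"
    and sym23: "\<And>x y z w. M x y z w = M x z y w"
    and sym34: "\<And>x y z w. M x y z w = M x y w z"
    and diag: "\<And>x. M x x x x = 0"
  shows "M x y z w = 0"
proof -
  have add2: "M w (x + x') z v = M w x z v + M w x' z v" for w x x' z v
    using add sym12 by metis
  have add3: "M w z (x + x') v = M w z x v + M w z x' v" for w x x' z v
    using add2 sym23 by metis
  have add4: "M w z v (x + x') = M w z v x + M w z v x'" for w x x' z v
    using add3 sym34 by metis
  note minus = additive_minus(2)[of "\<lambda>x. M x _ _ _", OF add]
      additive_minus(2)[of "\<lambda>x. M _ x _ _", OF add2]
    additive_minus(2)[of "\<lambda>x. M _ _ x _", OF add3] additive_minus(2)[of "\<lambda>x. M _ _ _ x", OF add4]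
  have D: "M x x y y = 0" for x y
  proof -
    have yx: "M y x x y = M x x y y" "M y x y x = M x x y y" "M x y x y = M x x y y" "M x y y x =
        M x x y y"
       "M y y x x = M x x y y" "M x x y x = M x x x y" "M x y x x = M x x x y" "M y x x x = M x x
           x y"
       "M y x y y = M x y y y" "M y y x y = M x y y y" "M y y y x = M x y y y"
      by (simp_all add: sym12 sym23 sym34)
    let ?w = "M x x y y + M x x y y + M x x y y"
    let ?o = "M x x x y + M x x x y + M x x x y + M x x x y + M x y y y + M x y y y + M x y y y +
        M x y y y"
    have p: "M (x + y) (x + y) (x + y) (x + y) = ?o + (?w + ?w)"
      by (simp only: add add2 add3 add4) (simp add: diag yx)
    have m: "M (x + - y) (x + - y) (x + - y) (x + - y) = - ?o + (?w + ?w)"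
      by (simp only: add add2 add3 add4 minus) (simp add: diag yx)
    have "(?w + ?w) + (?w + ?w) = M (x + y) (x + y) (x + y) (x + y) + M (x + - y) (x + - y) (x +
        - y) (x + - y)"
      unfolding p m by (simp add: algebra_simps)
    then have "(?w + ?w) + (?w + ?w) = 0" by (simp only: diag) simp
    then have "?w = 0" by (rule two[OF two])
    then show ?thesis by (rule three)
  qed
  have D2: "M x y z z = 0" for x y z
    by (rule polarize2[where Q = "\<lambda>x y. M x y z z"], erule two) (rule add, rule sym12, rule D)
  show ?thesis
    by (rule polarize2[where Q = "M x y"], erule two) (rule add3, rule sym34, rule D2)
qed

section \<open>Arithmetic with numerals in modules, rings with involution\<close>

text \<open>
  Linear identities with scalars are proved by expanding into monomials. The simplifier collects
  equal scalars into numerals; \<open>numeral_to_front\<close> and \<open>scale_mult_numeral\<close> undo this, so that equal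
  monomials cancel.
\<close>

lemma numeral_to_front:
  fixes a b :: "'a::comm_ring_1"
  shows "a * (numeral w * b) = numeral w * (a * b)" "a * numeral w = numeral w * a"
  by (simp_all only: mult_ac)

context module
begin

lemma scale_2: "scale 2 x = x + x"
  by (simp only: one_add_one[symmetric] scale_left_distrib scale_one)

lemma scale_mult_numeral:
  "scale (r * 2) x = scale r x + scale r x" "scale (2 * r) x = scale r x + scale r x"
  "scale (r * 3) x = scale r x + scale r x + scale r x" "scale (3 * r) x = scale r x + scale r x
      + scale r x"
  "scale (r * 4) x = scale r x + scale r x + scale r x + scale r x"
  "scale (4 * r) x = scale r x + scale r x + scale r x + scale r x"
  "scale (r * 6) x = scale r x + scale r x + scale r x + scale r x + scale r x + scale r x"
  "scale (6 * r) x = scale r x + scale r x + scale r x + scale r x + scale r x + scale r x"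
proof -
  have 2: "2 * r = r + r" and 3: "3 * r = r + r + r" and 4: "4 * r = r + r + r + r"
    and 6: "6 * r = r + r + r + r + r + r" by simp_all
  show "scale (2 * r) x = scale r x + scale r x" "scale (3 * r) x = scale r x + scale r x + scale
      r x"
    "scale (4 * r) x = scale r x + scale r x + scale r x + scale r x"
    "scale (6 * r) x = scale r x + scale r x + scale r x + scale r x + scale r x + scale r x"
    by (simp_all only: 2 3 4 6 scale_left_distrib)
  then show "scale (r * 2) x = scale r x + scale r x" "scale (r * 3) x = scale r x + scale r x +
      scale r x"
    "scale (r * 4) x = scale r x + scale r x + scale r x + scale r x"
    "scale (r * 6) x = scale r x + scale r x + scale r x + scale r x + scale r x + scale r x"
    by (simp_all only: mult.commute[of r])
qed

end

locale involutive_ring =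
  fixes \<sigma> :: "'k::comm_ring_1 \<Rightarrow> 'k"
  assumes sigma_add: "\<sigma> (a + b) = \<sigma> a + \<sigma> b" and sigma_mult: "\<sigma> (a * b) = \<sigma> a * \<sigma> b"
    and sigma_1: "\<sigma> 1 = 1" and sigma_sigma: "\<sigma> (\<sigma> a) = a"
begin

lemma sigma_0: "\<sigma> 0 = 0" and sigma_minus: "\<sigma> (- a) = - \<sigma> a" and sigma_diff: "\<sigma> (a - b) = \<sigma> a - \<sigma> b"
  using additive_minus[of \<sigma>] sigma_add by auto

lemma sigma_numeral: "\<sigma> (numeral m) = numeral m"
  by (induction m) (simp_all only: numeral.simps sigma_1 sigma_add)

lemmas sigma_simps = sigma_0 sigma_1 sigma_minus sigma_diff sigma_add sigma_mult sigma_sigma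
    sigma_numeral

end

section \<open>Quadratic etale extensions\<close>

lemma CHAR_neq_prime_nonzero:
  assumes "CHAR('f::field) \<noteq> p" and "prime p"
  shows "(of_nat p :: 'f) \<noteq> 0"
proof
  assume "(of_nat p :: 'f) = 0"
  then have "CHAR('f) dvd p" by (simp add: of_nat_eq_0_iff_char_dvd)
  moreover have "CHAR('f) \<noteq> 1" by simp
  ultimately show False using assms prime_nat_iff by blast
qed

context quadratic_etale_extension
begin

lemma iota_add: "\<iota> (a + b) = \<iota> a + \<iota> b" and iota_mult: "\<iota> (a * b) = \<iota> a * \<iota> b" and iota_1: "\<iota> 1 = 1"
  using algebra_map by (auto simp: algebra_map_def)

lemma iota_0: "\<iota> 0 = 0" and iota_minus: "\<iota> (- a) = - \<iota> a" and iota_diff: "\<iota> (a - b) = \<iota> a - \<iota> b"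
  using additive_minus[of \<iota>] iota_add by auto

lemma iota_inj: "\<iota> a = \<iota> b \<Longrightarrow> a = b"
proof (rule ccontr)
  assume "\<iota> a = \<iota> b" "a \<noteq> b"
  then have "\<iota> ((a - b) * inverse (a - b)) = 0" unfolding iota_mult iota_diff by simp
  with \<open>a \<noteq> b\<close> show False by (simp add: iota_1)
qed

lemma aut_add: "\<sigma> (a + b) = \<sigma> a + \<sigma> b" and aut_mult: "\<sigma> (a * b) = \<sigma> a * \<sigma> b" and aut_1: "\<sigma> 1 = 1"
  using automorphism by (auto simp: ring_automorphism_def)

lemma aut_minus: "\<sigma> (- a) = - \<sigma> a" and aut_diff: "\<sigma> (a - b) = \<sigma> a - \<sigma> b"
  using additive_minus[of \<sigma>] aut_add by auto

lemma vector_space_K: "vector_space (\<lambda>c x. \<iota> c * x)"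
  by unfold_locales (simp_all add: iota_add iota_mult iota_1 algebra_simps)

text \<open>
  The set \<open>{y, 1}\<close> is independent, and a basis that contains it has two elements.
\<close>

lemma field_case_basis:
  assumes "vector_space.dim (\<lambda>c x. \<iota> c * x) (UNIV :: 'k set) = 2" and y: "y \<notin> range \<iota>"
  shows "\<exists>a b. x = \<iota> a + \<iota> b * y"
proof -
  interpret K: vector_space "\<lambda>c x. \<iota> c * x" by (rule vector_space_K)
  have "K.independent {y, 1}"
  proof (rule K.independent_insertI)
    show "y \<notin> K.span {1}" using y by (auto simp: K.span_singleton)
    have "(1::'k) \<noteq> 0" using y iota_0 iota_1
      by (metis mult_1 mult_zero_left rangeI)
    then show "K.independent {1}" by simp
  qed
  moreover have "y \<noteq> 1" using y iota_1 by (metis rangeI)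
  moreover define B where "B = K.extend_basis {y, 1}"
  ultimately have B: "{y, 1} \<subseteq> B" "K.span B = UNIV" "card B = 2" "K.independent B"
    using K.extend_basis_superset K.independent_extend_basis K.span_extend_basis
      K.dim_eq_card[of B UNIV] assms(1) by auto
  have "finite B" using B(3) card.infinite by force
  then have "{y, 1} = B" using B \<open>y \<noteq> 1\<close> by (intro card_subset_eq) auto
  with B have "K.span {y, 1} = UNIV" by simp
  then have "x \<in> K.span {y, 1}" by auto
  then obtain k where "x - \<iota> k * y \<in> K.span {1}" by (auto simp: K.span_insert)
  then obtain c where "x - \<iota> k * y = \<iota> c" by (auto simp: K.span_singleton)
  then have "x = \<iota> c + \<iota> k * y" by (simp add: algebra_simps)
  then show ?thesis by blast
qed

text \<open>
  The four properties of \<open>K\<close> and \<open>\<sigma>\<close> on which everything else is based. In the field case an element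
  \<open>y\<close> that is moved by \<open>\<sigma>\<close> and its image are the two roots of one quadratic polynomial \<open>X\<^sup>2 - b X - a\<close>, so
  \<open>\<sigma> y = b - y\<close>; in the split case everything can be read off in \<open>F \<times> F\<close>.
\<close>

lemma structure_of_quadratic_etale:
  shows aut_aut: "\<sigma> (\<sigma> x) = x"
    and fixed_in_base: "\<sigma> x = x \<Longrightarrow> x \<in> range \<iota>"
    and ex_skew_unit: "\<exists>\<epsilon> \<epsilon>'. \<epsilon> * \<epsilon>' = 1 \<and> \<sigma> \<epsilon> = - \<epsilon>"
    and reduced: "(y::'k) * y = 0 \<Longrightarrow> y = 0"
proof -
  have "(\<forall>x. \<sigma> (\<sigma> x) = x) \<and> (\<forall>x. \<sigma> x = x \<longrightarrow> x \<in> range \<iota>) \<and>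
     (\<exists>\<epsilon> \<epsilon>'. \<epsilon> * \<epsilon>' = 1 \<and> \<sigma> \<epsilon> = - \<epsilon>) \<and> (\<forall>y::'k. y * y = 0 \<longrightarrow> y = 0)"
    using field_or_split
  proof
    assume F: "separable_quadratic_field \<iota> \<and> \<sigma> \<noteq> id"
    then have inv: "\<exists>x'. x * x' = 1" if "x \<noteq> 0" for x :: 'k
      using that unfolding separable_quadratic_field_def dvd_def by metis
    from F have dim: "vector_space.dim (\<lambda>c x. \<iota> c * x) (UNIV :: 'k set) = 2"
      by (simp add: separable_quadratic_field_def)
    have dom: "x = 0 \<or> y = 0" if xy: "x * y = 0" for x y :: 'k
    proof (cases "x = 0")
      case False
      then obtain x' where "x * x' = 1" using inv by blast
      then have "y = x' * (x * y)" by (simp add: mult.assoc[symmetric] mult.commute[of x'])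
      also have "\<dots> = 0" using xy by simp
      finally show ?thesis by simp
    qed simp
    from F obtain y where y: "\<sigma> y \<noteq> y" by (metis eq_id_iff)
    have yb: "z \<notin> range \<iota>" if "\<sigma> z \<noteq> z" for z using that fixes_base by auto
    obtain a b where ab: "y * y = \<iota> a + \<iota> b * y" using field_case_basis[OF dim yb[OF y]] by blast
    have "\<sigma> y * \<sigma> y = \<iota> a + \<iota> b * \<sigma> y"
      using arg_cong[OF ab, of \<sigma>] by (simp add: aut_mult aut_add fixes_base)
    then have "(\<sigma> y - y) * (\<sigma> y + y - \<iota> b) = 0" using ab by (simp add: algebra_simps)
    from dom[OF this] have "\<sigma> y + y - \<iota> b = 0" using y by (metis eq_iff_diff_eq_0)
    then have sy: "\<sigma> y = \<iota> b - y" by (simp add: eq_diff_eq)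
    have 1: "\<sigma> (\<sigma> x) = x" for x
    proof -
      obtain c d where "x = \<iota> c + \<iota> d * y" using field_case_basis[OF dim yb[OF y]] by blast
      then show ?thesis by (simp add: aut_mult aut_add aut_diff fixes_base sy)
    qed
    have 2: "x \<in> range \<iota>" if fx: "\<sigma> x = x" for x
    proof (rule ccontr)
      assume "x \<notin> range \<iota>"
      then obtain c d where "y = \<iota> c + \<iota> d * x" using field_case_basis[OF dim] by blast
      with fx have "\<sigma> y = y" by (simp add: aut_mult aut_add fixes_base)
      with y show False by simp
    qed
    have "\<sigma> (\<sigma> y - y) = - (\<sigma> y - y)" by (simp add: aut_diff 1)
    then have 3: "\<exists>\<epsilon> \<epsilon>'. \<epsilon> * \<epsilon>' = 1 \<and> \<sigma> \<epsilon> = - \<epsilon>"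
      using inv[of "\<sigma> y - y"] y by (metis eq_iff_diff_eq_0)
    have 4: "y = 0" if "y * y = 0" for y :: 'k using dom[OF that] by blast
    show ?thesis
      by (intro conjI allI impI) (rule 1, erule 2, rule 3, erule 4)
  next
    assume "\<exists>h. split_algebra_iso \<iota> h \<and> (\<forall>x. h (\<sigma> x) = prod.swap (h x))"
    then obtain h where h: "bij h" "\<And>c. h (\<iota> c) = (c, c)"
      "\<And>x y. h (x + y) = h x + h y"
      "\<And>x y. h (x * y) = (fst (h x) * fst (h y), snd (h x) * snd (h y))"
      "\<And>x. h (\<sigma> x) = prod.swap (h x)"
      unfolding split_algebra_iso_def by blast
    have inj: "x = y" if "h x = h y" for x y using h(1) that by (auto simp: bij_def inj_def)
    have h1: "h 1 = (1, 1)" using h(2)[of 1] iota_1 by simp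
    have h0: "h 0 = (0, 0)" using h(2)[of 0] iota_0 by simp
    have hm: "h (- x) = - h x" for x using additive_minus(2)[of h] h(3) by auto
    have 1: "\<sigma> (\<sigma> x) = x" for x by (rule inj) (simp add: h)
    have 2: "x \<in> range \<iota>" if "\<sigma> x = x" for x
    proof -
      have "prod.swap (h x) = h x" using h(5)[of x] that by simp
      then have "h x = h (\<iota> (fst (h x)))" unfolding h(2) by (metis fst_swap prod.collapse)
      then have "x = \<iota> (fst (h x))" by (rule inj)
      then show ?thesis by (rule range_eqI)
    qed
    obtain \<epsilon> where e: "h \<epsilon> = (1, -1)" using surjD[OF bij_is_surj[OF h(1)], of "(1, -1)"] by metis
    have "\<epsilon> * \<epsilon> = 1" "\<sigma> \<epsilon> = - \<epsilon>" by (rule inj, simp add: h h1 hm e)+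
    then have 3: "\<exists>\<epsilon> \<epsilon>'. \<epsilon> * \<epsilon>' = 1 \<and> \<sigma> \<epsilon> = - \<epsilon>" by blast
    have 4: "y = 0" if "y * y = 0" for y :: 'k
    proof (rule inj)
      have "h (y * y) = (0, 0)" using that h0 by simp
      then show "h y = h 0" by (simp add: h h0 prod_eq_iff)
    qed
    show ?thesis
      by (intro conjI allI impI) (rule 1, erule 2, rule 3, erule 4)
  qed
  note all = this
  show "\<sigma> (\<sigma> x) = x" by (rule all[THEN conjunct1, rule_format])
  show "\<sigma> x = x \<Longrightarrow> x \<in> range \<iota>"
    by (rule all[THEN conjunct2, THEN conjunct1, rule_format])
  show "\<exists>\<epsilon> \<epsilon>'. \<epsilon> * \<epsilon>' = 1 \<and> \<sigma> \<epsilon> = - \<epsilon>"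
    by (rule all[THEN conjunct2, THEN conjunct2, THEN conjunct1])
  show "y * y = 0 \<Longrightarrow> y = 0"
    by (rule all[THEN conjunct2, THEN conjunct2, THEN conjunct2, rule_format])
qed

sublocale involutive_ring \<sigma>
  by standard (rule aut_add aut_mult aut_1 aut_aut)+

end

section \<open>Identities of cubic norm structures\<close>

locale bilinear_cubic_norm_structure = cubic_norm_structure smul N sharp T e
  for smul :: "'k::comm_ring_1 \<Rightarrow> 'j::ab_group_add \<Rightarrow> 'j" and N sharp T e +
  assumes quadratic: "quadratic_map smul sharp"
    and six: "\<exists>i::'k. 6 * i = 1"
begin

abbreviation cross_product :: "'j \<Rightarrow> 'j \<Rightarrow> 'j" (infixl \<open>\<otimes>\<close> 70)
  where "a \<otimes> b \<equiv> cross sharp a b"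

abbreviation trace :: "'j \<Rightarrow> 'k" (\<open>t\<close>) where "t a \<equiv> T a e"

lemma two_three_cancel_K:
  "(x::'k) + x = 0 \<Longrightarrow> x = 0" "(x::'k) + x + x = 0 \<Longrightarrow> x = 0"
proof -
  obtain i :: 'k where i: "6 * i = 1" using six by blast
  have eq: "(3 * i) * (x + x) = (6 * i) * x" "(2 * i) * (x + x + x) = (6 * i) * x"
    by (simp_all add: algebra_simps)
  show "x = 0" if "x + x = 0" using eq(1) unfolding that i by simp
  show "x = 0" if "x + x + x = 0" using eq(2) unfolding that i by simp
qed

lemma two_three_cancel_J:
  "(x::'j) + x = 0 \<Longrightarrow> x = 0" "(x::'j) + x + x = 0 \<Longrightarrow> x = 0"
proof -
  obtain i :: 'k where i: "6 * i = 1" using six by blast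
  have 3: "smul 3 x = x + x + x"
  proof -
    have "(3::'k) = 1 + 1 + 1" by simp
    then show ?thesis by (simp only: scale_left_distrib scale_one)
  qed
  have "smul (i * 3) (smul 2 x) = smul (6 * i) x" "smul (i * 2) (smul 3 x) = smul (6 * i) x"
    by (simp_all add: algebra_simps)
  then have eq: "smul (i * 3) (x + x) = x" "smul (i * 2) (x + x + x) = x"
    unfolding 3 scale_2 i by simp_all
  show "x = 0" if "x + x = 0" using eq(1) unfolding that by simp
  show "x = 0" if "x + x + x = 0" using eq(2) unfolding that by simp
qed

lemma T_add_right: "T a (b + c) = T a b + T a c" and T_smul_right: "T a (smul r b) = r * T a b"
  using T_linear[of a] by (auto simp: module_hom_iff)

lemma T_add_left: "T (b + c) a = T b a + T c a" and T_smul_left: "T (smul r b) a = r * T b a"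
  by (simp_all only: T_sym[of _ a] T_add_right T_smul_right)

lemma cross_commute: "a \<otimes> b = b \<otimes> a"
  by (simp add: cross_def add.commute)

lemma cross_add_right: "a \<otimes> (b + c) = a \<otimes> b + a \<otimes> c"
  and cross_smul_right: "a \<otimes> smul r b = smul r (a \<otimes> b)"
  using quadratic by (auto simp: quadratic_map_def module_hom_iff)

lemma cross_add_left: "(b + c) \<otimes> a = b \<otimes> a + c \<otimes> a"
  and cross_smul_left: "smul r b \<otimes> a = smul r (b \<otimes> a)"
  by (simp_all only: cross_commute[of _ a] cross_add_right cross_smul_right)

lemmas T_minus = additive_minus[of "T a" for a, OF T_add_right]
    additive_minus[of "\<lambda>b. T b a" for a, OF T_add_left]
lemmas cross_minus = additive_minus[of "(\<otimes>) a" for a, OF cross_add_right]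
  additive_minus[of "\<lambda>b. b \<otimes> a" for a, OF cross_add_left]

lemmas bilinear_simps = T_add_right T_add_left T_smul_right T_smul_left T_minus
  cross_add_right cross_add_left cross_smul_right cross_smul_left cross_minus

lemma sharp_add: "sharp (a + b) = sharp a + a \<otimes> b + sharp b"
  by (simp add: cross_def)

lemma cross_self: "a \<otimes> a = sharp a + sharp a"
proof -
  have "sharp (a + a) = smul 2 (smul 2 (sharp a))"
    using sharp_smul[of 2 a] by (simp only: scale_2 power2_eq_square scale_scale[symmetric])
  then show ?thesis by (simp add: cross_def scale_2)
qed

end

text \<open>
  Both sides are the trilinear part of \<open>N\<close>: expand \<open>N (a + b + c)\<close> with either bracketing.
\<close>

lemma (in cubic_norm_structure) trilinear_cyclic:
  "T a (cross sharp b c) = T c (cross sharp a b)"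
proof -
  have T_add1: "T a (b + c) = T a b + T a c" for a b c
    using T_linear by (auto simp: module_hom_iff)
  have T_add2: "T (b + c) a = T b a + T c a" for a b c
    using T_add1[of a b c] by (simp only: T_sym[of a])
  have sharp_add: "sharp (a + b) = sharp a + cross sharp a b + sharp b" for a b
    by (simp add: cross_def)
  have "N ((a + b) + c) = N (a + (b + c))" by (simp only: add.assoc)
  then show ?thesis
    by (simp only: N_add sharp_add T_add1 T_add2) (simp add: algebra_simps
        T_sym[of "cross sharp a b"])
qed

text \<open>
  By \<open>trilinear_cyclic\<close> the element \<open>a \<times> b\<close> is paired by \<open>T\<close> with \<open>d\<close> as \<open>b\<close> is paired with \<open>d \<times> a\<close>,
  and the latter is linear in \<open>b\<close>.
\<close>

lemma (in cubic_norm_structure) nondegenerate_imp_quadratic_map: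
  assumes nd: "nondegenerate T"
  shows "quadratic_map smul sharp"
proof -
  have lin: "T a (b + c) = T a b + T a c" "T a (smul r b) = r * T a b" for a b c r
    using T_linear by (auto simp: module_hom_iff)
  have lin': "T (b + c) a = T b a + T c a" "T (smul r b) a = r * T b a" for a b c r
    using lin T_sym by metis+
  have eq: "x = y" if "\<And>d. T d x = T d y" for x y
  proof -
    have "T (x - y) d = 0" for d
      using lin(1)[of d "x - y" y] that[of d] T_sym[of d "x - y"] by simp
    then show ?thesis using nd unfolding nondegenerate_def by (metis eq_iff_diff_eq_0)
  qed
  have cyc: "T d (cross sharp a b) = T b (cross sharp d a)" for a b d by (rule trilinear_cyclic)
  have 1: "cross sharp a (b + c) = cross sharp a b + cross sharp a c" for a b c
    by (rule eq) (simp only: cyc[of _ a] lin lin')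
  have 2: "cross sharp a (smul r b) = smul r (cross sharp a b)" for a b r
    by (rule eq) (simp only: cyc[of _ a] lin lin')
  show ?thesis
    unfolding quadratic_map_def module_hom_iff
    by (intro conjI allI sharp_smul 1 2 module_axioms)
qed

context bilinear_cubic_norm_structure
begin

lemma T_cross_swap: "T (a \<otimes> b) c = T a (b \<otimes> c)"
  by (simp only: T_sym[of "a \<otimes> b"] trilinear_cyclic[of a b c])

lemma T_cross_left_commute: "T a (b \<otimes> c) = T b (a \<otimes> c)"
  by (subst (1 2) T_cross_swap[symmetric]) (simp only: cross_commute[of a b])

lemma T_cross_self: "T a (a \<otimes> c) = T c (sharp a) + T c (sharp a)"
  by (simp only: T_cross_swap[symmetric] cross_self T_sym[of _ c] T_add_right)

lemma T_sharp_self: "T a (sharp a) = N a + N a + N a"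
proof -
  have "N (a + a) = 2 ^ 3 * N a"
    using N_smul[of 2 a] by (simp only: scale_2)
  then have "(T a (sharp a) - (N a + N a + N a)) + (T a (sharp a) - (N a + N a + N a)) = 0"
    by (simp add: N_add algebra_simps)
  from two_three_cancel_K(1)[OF this] show ?thesis by simp
qed

lemma cross_e: "e \<otimes> a = smul (t a) e - a" "a \<otimes> e = smul (t a) e - a"
proof -
  have "Y = X - a" if "a = X - Y" for X Y using that by (simp add: algebra_simps)
  from this[OF unit_cross] show "e \<otimes> a = smul (t a) e - a" .
  then show "a \<otimes> e = smul (t a) e - a" by (simp only: cross_commute[of a e])
qed

text \<open>
  The full linearization of \<open>a\<^sup>\<sharp>\<^sup>\<sharp> = N(a) a\<close>.
\<close>

lemma adjoint_linearized4:
  "(a \<otimes> b) \<otimes> (c \<otimes> d) + (a \<otimes> c) \<otimes> (b \<otimes> d) + (a \<otimes> d) \<otimes> (b \<otimes> c) =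
    smul (T a (b \<otimes> c)) d + smul (T b (c \<otimes> d)) a + smul (T a (c \<otimes> d)) b + smul (T a (b \<otimes> d)) c"
proof -
  define M where "M a b c d = (a \<otimes> b) \<otimes> (c \<otimes> d) + (a \<otimes> c) \<otimes> (b \<otimes> d) + (a \<otimes> d) \<otimes> (b \<otimes> c) -
    (smul (T a (b \<otimes> c)) d + smul (T b (c \<otimes> d)) a + smul (T a (c \<otimes> d)) b + smul (T a (b \<otimes> d)) c)"
    for a b c d
  have "M a b c d = 0"
  proof (rule polarize4[where M = M])
    show "M (a + a') b c d = M a b c d + M a' b c d" for a a' b c d
      by (simp add: M_def bilinear_simps scale_right_distrib scale_left_distrib algebra_simps)
    show "M a b c d = M b a c d" for a b c d
      unfolding M_def using cross_commute[of a b] T_cross_left_commute[of a b]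
          cross_commute[of "a \<otimes> c" "b \<otimes> d"]
         cross_commute[of "a \<otimes> d" "b \<otimes> c"] by (simp add: algebra_simps)
    show "M a b c d = M a c b d" for a b c d
      unfolding M_def using cross_commute[of c b] T_cross_left_commute[of b c]
          by (simp add: algebra_simps)
    show "M a b c d = M a b d c" for a b c d
      unfolding M_def using cross_commute[of c d] T_cross_left_commute[of b c]
          cross_commute[of "b \<otimes> d" "b \<otimes> c"]
       by (simp add: algebra_simps)
    show "M a a a a = 0" for a
    proof -
      have key: "(sharp a + sharp a) \<otimes> (sharp a + sharp a) = smul (8 * N a) a"
      proof -
        have "smul (8 * N a) a = smul (2 * (2 * (2 * N a))) a" by simp
        also have "\<dots> = (sharp a + sharp a) \<otimes> (sharp a + sharp a)"
          unfolding bilinear_simps cross_self[of "sharp a"] sharp_sharp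
              by (simp only: scale_mult_numeral)
        finally show ?thesis by simp
      qed
      show ?thesis
        by (simp add: M_def cross_self[of a] key T_add_right T_sharp_self
            scale_left_distrib[symmetric]
             del: scale_left_distrib)
    qed
  qed (erule two_three_cancel_J)+
  then show ?thesis by (simp add: M_def)
qed

lemma adjoint_linearized2:
  "(a \<otimes> d) \<otimes> (a \<otimes> c) + sharp a \<otimes> (d \<otimes> c) =
    smul (T d (sharp a)) c + smul (T c (a \<otimes> d)) a + smul (T c (sharp a)) d" (is "?l = ?r")
proof -
  have "?l + ?l = ?r + ?r"
    using adjoint_linearized4[of a a d c]
    by (simp add: cross_self bilinear_simps scale_left_distrib T_cross_left_commute[of d a]
        T_cross_left_commute[of c a]
      cross_commute[of d c] cross_commute[of "a \<otimes> c" "a \<otimes> d"] T_cross_self scale_mult_numeral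
          algebra_simps)
  then have "(?l - ?r) + (?l - ?r) = 0" by (simp add: algebra_simps)
  from two_three_cancel_J(1)[OF this] show ?thesis by simp
qed

lemma adjoint_linearized1: "sharp a \<otimes> (a \<otimes> b) = smul (N a) b + smul (T b (sharp a)) a"
    (is "?l = ?r")
proof -
  have "?l + ?l + ?l = ?r + ?r + ?r"
    using adjoint_linearized2[of a a b]
    by (simp add: cross_self bilinear_simps T_sharp_self scale_mult_numeral scale_left_distrib
        algebra_simps)
  then have "(?l - ?r) + (?l - ?r) + (?l - ?r) = 0" by (simp add: algebra_simps)
  from two_three_cancel_J(2)[OF this] show ?thesis by simp
qed

text \<open>
  The case of \<open>adjoint_linearized2\<close> in which one argument is the unit, where \<open>\<times>\<close> is known by \<open>cross_e\<close>.
\<close>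

lemma cross_cross:
  "a \<otimes> (a \<otimes> c) = smul (t a * t (a \<otimes> c) + t c * t (sharp a) - T c (sharp a)) e - smul (t (a \<otimes> c)) a
     - smul (t a) (a \<otimes> c) - smul (t c) (sharp a) - smul (t (sharp a)) c - sharp a \<otimes> c"
proof -
  have 1: "T c (a \<otimes> e) = t (a \<otimes> c)" by (simp only: T_cross_swap T_cross_left_commute[of c a])
  have 2: "(a \<otimes> e) \<otimes> (a \<otimes> c) = smul (t a * t (a \<otimes> c)) e - smul (t a) (a \<otimes> c) - a \<otimes> (a \<otimes> c)"
    unfolding cross_e(2)[of a] by (simp add: bilinear_simps cross_e algebra_simps)
  have 3: "sharp a \<otimes> (e \<otimes> c) = smul (t c * t (sharp a)) e - smul (t c) (sharp a) - sharp a \<otimes> c"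
    by (simp add: bilinear_simps cross_e algebra_simps)
  show ?thesis
    using adjoint_linearized2[of a e c] unfolding 1 2 3 T_sym[of e "sharp a"]
    by (simp add: scale_left_distrib algebra_simps)
qed

lemma cross_sharp_self:
  "a \<otimes> sharp a = smul (t a * t (sharp a) - N a) e - smul (t a) (sharp a) - smul (t (sharp a)) a"
      (is "?l = ?r")
proof -
  have "?l + ?l + ?l = ?r + ?r + ?r"
    using cross_cross[of a a]
    by (simp add: cross_commute[of "sharp a" a] cross_self bilinear_simps T_sharp_self
        scale_mult_numeral
       scale_left_distrib scale_left_diff_distrib algebra_simps)
  then have "(?l - ?r) + (?l - ?r) + (?l - ?r) = 0" by (simp add: algebra_simps)
  from two_three_cancel_J(2)[OF this] show ?thesis by simp
qed

text \<open>
  If \<open>T\<close> is non-degenerate, this is \<open>adjoint_linearized1\<close> paired with an arbitrary element. In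
  general, \<open>cross_cross\<close> expresses \<open>a\<^sup>\<sharp> \<times> _\<close> by \<open>- a \<times> (a \<times> _)\<close> and simpler terms; therefore
  \<open>a\<^sup>\<sharp> \<times> (a \<times> c)\<close> and \<open>a \<times> (a\<^sup>\<sharp> \<times> c)\<close> both equal \<open>- a \<times> (a \<times> (a \<times> c))\<close> up to simpler terms, and the
  former is known.
\<close>

lemma cross_sharp_cross: "a \<otimes> (sharp a \<otimes> c) = smul (N a) c + smul (T a c) (sharp a)"
proof -
  have 0: "t (a \<otimes> b) = t a * t b - T a b" for a b
    by (simp add: T_cross_swap cross_e bilinear_simps mult.commute)
  have 1: "T (a \<otimes> c) a = T c (sharp a) + T c (sharp a)"
    using T_cross_swap[of c a a] cross_commute[of a c] by (simp add: cross_self bilinear_simps)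
  have 2: "T (a \<otimes> c) (sharp a) = T c (a \<otimes> sharp a)"
      by (simp only: T_cross_swap T_cross_left_commute[of c a])
  have A: "sharp a \<otimes> (a \<otimes> c) + a \<otimes> (a \<otimes> (a \<otimes> c)) =
     smul (t a * t (a \<otimes> (a \<otimes> c)) + t (a \<otimes> c) * t (sharp a) - T (a \<otimes> c) (sharp a)) e
     - smul (t (a \<otimes> (a \<otimes> c))) a
     - smul (t a) (a \<otimes> (a \<otimes> c)) - smul (t (a \<otimes> c)) (sharp a) - smul (t (sharp a)) (a \<otimes> c)"
    using cross_cross[of a "a \<otimes> c"] by (simp add: algebra_simps)
  have "a \<otimes> (a \<otimes> c) + sharp a \<otimes> c = smul (t a * t (a \<otimes> c) + t c * t (sharp a) - T c (sharp a)) e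
      - smul (t (a \<otimes> c)) a
     - smul (t a) (a \<otimes> c) - smul (t c) (sharp a) - smul (t (sharp a)) c"
    using cross_cross[of a c] by (simp add: algebra_simps)
  from arg_cong[OF this, of "\<lambda>x. a \<otimes> x"]
  have B: "a \<otimes> (a \<otimes> (a \<otimes> c)) + a \<otimes> (sharp a \<otimes> c) =
    smul (t a * t (a \<otimes> c) + t c * t (sharp a) - T c (sharp a)) (smul (t a) e - a)
    - smul (t (a \<otimes> c)) (sharp a + sharp a)
     - smul (t a) (a \<otimes> (a \<otimes> c)) - smul (t c) (a \<otimes> sharp a) - smul (t (sharp a)) (a \<otimes> c)"
    by (simp add: bilinear_simps cross_e cross_self)
  have "a \<otimes> (sharp a \<otimes> c) = sharp a \<otimes> (a \<otimes> c) +
     (a \<otimes> (a \<otimes> (a \<otimes> c)) + a \<otimes> (sharp a \<otimes> c)) - (sharp a \<otimes> (a \<otimes> c) + a \<otimes> (a \<otimes> (a \<otimes> c)))" by simp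
  also have "\<dots> = smul (N a) c + smul (T a c) (sharp a)"
    unfolding A B unfolding adjoint_linearized1 2 cross_sharp_self
    by (simp add: 0 bilinear_simps 1 T_cross_self T_sym[of c a] scale_mult_numeral
        scale_right_distrib scale_left_distrib
       scale_right_diff_distrib scale_left_diff_distrib algebra_simps)
  finally show ?thesis .
qed

lemma cross_sharp_cross_linearized:
  "d \<otimes> (sharp a \<otimes> c) + a \<otimes> ((a \<otimes> d) \<otimes> c) =
    smul (T d (sharp a)) c + smul (T d c) (sharp a) + smul (T a c) (a \<otimes> d)" (is "?l = ?r")
proof -
  define M where "M a b d = a \<otimes> ((b \<otimes> d) \<otimes> c) + b \<otimes> ((a \<otimes> d) \<otimes> c) + d \<otimes> ((a \<otimes> b) \<otimes> c) -
    (smul (T a (b \<otimes> d)) c + smul (T a c) (b \<otimes> d) + smul (T b c) (a \<otimes> d) + smul (T d c) (a \<otimes> b))"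
    for a b d
  have "M a a d = 0"
  proof (rule polarize3[where M = M])
    show "M (a + a') b d = M a b d + M a' b d" for a a' b d
      by (simp add: M_def bilinear_simps scale_right_distrib scale_left_distrib algebra_simps)
    show "M a b d = M b a d" for a b d
      unfolding M_def using cross_commute[of a b] T_cross_left_commute[of a b]
          by (simp add: algebra_simps)
    show "M a b d = M a d b" for a b d
      unfolding M_def using cross_commute[of d b] by (simp add: algebra_simps)
    show "M a a a = 0" for a
      by (simp add: M_def cross_self bilinear_simps cross_sharp_cross T_sharp_self
          scale_mult_numeral
        scale_left_distrib scale_right_distrib algebra_simps)
  qed (erule two_three_cancel_J)+
  then have "(?l - ?r) + (?l - ?r) = 0"
    by (simp add: M_def cross_self bilinear_simps T_cross_self cross_commute[of d a]
       scale_mult_numeral scale_left_distrib scale_right_distrib algebra_simps)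
  from two_three_cancel_J(1)[OF this] show ?thesis by simp
qed

end

section \<open>Hermitian cubic norm structures\<close>

text \<open>
  The two linearized identities correspond to the linearizations of \<open>a\<^sup>\<sharp> \<times> (a \<times> c)\<close> and
  \<open>a \<times> (a\<^sup>\<sharp> \<times> c)\<close> in a cubic norm structure; the conjugations come from the semilinearity of \<open>\<circ>\<close>.
  For \<open>K = F \<oplus> F\<close> with the exchange map, such a structure amounts to two \<open>F\<close>-spaces with a bilinear
  pairing between them and a quadratic map from each to the other.
\<close>

locale hermitian_cubic_norm_structure = module smul + involutive_ring \<sigma>
  for smul :: "'k::comm_ring_1 \<Rightarrow> 'j::ab_group_add \<Rightarrow> 'j" and \<sigma> :: "'k \<Rightarrow> 'k" +
  fixes h :: "'j \<Rightarrow> 'j \<Rightarrow> 'k" and circ :: "'j \<Rightarrow> 'j \<Rightarrow> 'j" (infixl \<open>\<circ>\<^sub>J\<close> 70)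
    and adj :: "'j \<Rightarrow> 'j" and n :: "'j \<Rightarrow> 'k"
  assumes two_cancel: "(x::'j) + x = 0 \<Longrightarrow> x = 0" and three_cancel: "(x::'j) + x + x = 0 \<Longrightarrow> x = 0"
    and h_add_left: "h (a + b) c = h a c + h b c" and h_smul_left: "h (smul r a) b = r * h a b"
    and h_hermitian: "h b a = \<sigma> (h a b)"
    and circ_commute: "a \<circ>\<^sub>J b = b \<circ>\<^sub>J a"
    and circ_add_right: "a \<circ>\<^sub>J (b + c) = a \<circ>\<^sub>J b + a \<circ>\<^sub>J c"
    and circ_smul_right: "a \<circ>\<^sub>J smul r b = smul (\<sigma> r) (a \<circ>\<^sub>J b)"
    and h_circ: "h a (b \<circ>\<^sub>J c) = h b (a \<circ>\<^sub>J c)"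
    and circ_self: "a \<circ>\<^sub>J a = adj a + adj a"
    and h_adj_self: "h a (adj a) = n a + n a + n a"
    and circ_circ_linearized:
      "(a \<circ>\<^sub>J d) \<circ>\<^sub>J (a \<circ>\<^sub>J c) + adj a \<circ>\<^sub>J (d \<circ>\<^sub>J c) =
        smul (h d (adj a)) c + smul (h c (a \<circ>\<^sub>J d)) a + smul (h c (adj a)) d"
    and circ_adj_linearized:
      "d \<circ>\<^sub>J (adj a \<circ>\<^sub>J c) + a \<circ>\<^sub>J ((a \<circ>\<^sub>J d) \<circ>\<^sub>J c) =
        smul (\<sigma> (h d (adj a))) c + smul (h c d) (adj a) + smul (h c a) (a \<circ>\<^sub>J d)"

text \<open>
  Self-adjointness says \<open>U\<^sub>z = \<phi>\<^sup>2\<close> for \<open>z = \<phi> 1\<close>; the autotopy condition then becomes \<open>phi_sharp\<close>, with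
  \<open>\<delta> = N z\<close>.
\<close>

locale self_adjoint_autotopy = bilinear_cubic_norm_structure smul N sharp T e + involutive_ring \<sigma>
  for smul :: "'k::comm_ring_1 \<Rightarrow> 'j::ab_group_add \<Rightarrow> 'j" and N sharp T e and \<sigma> :: "'k \<Rightarrow> 'k" +
  fixes \<phi> :: "'j \<Rightarrow> 'j" and \<gamma> :: 'k and \<delta> :: 'k
  assumes reduced: "(y::'k) * y = 0 \<Longrightarrow> y = 0"
    and phi_semilinear: "semilinear smul \<sigma> \<phi>"
    and phi_surj: "surj \<phi>" and phi_inj: "inj \<phi>"
    and phi_sharp: "smul \<delta> (\<phi> (sharp a)) = \<phi> (\<phi> (sharp (\<phi> a)))"
    and gamma_delta: "\<sigma> \<gamma> * \<gamma> * \<delta> = 1"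
begin

lemma phi_add: "\<phi> (a + b) = \<phi> a + \<phi> b" and phi_smul: "\<phi> (smul r a) = smul (\<sigma> r) (\<phi> a)"
  using phi_semilinear by (auto simp: semilinear_def)

lemma sigma_delta: "\<sigma> \<delta> = \<delta>"
proof -
  have "\<sigma> \<delta> = \<sigma> \<delta> * (\<sigma> \<gamma> * \<gamma> * \<delta>)" by (simp add: gamma_delta)
  also have "\<dots> = \<sigma> (\<sigma> \<gamma> * \<gamma> * \<delta>) * \<delta>" by (simp only: sigma_simps mult_ac)
  finally show ?thesis by (simp add: gamma_delta sigma_1)
qed

lemma phi_0: "\<phi> 0 = 0" and phi_minus: "\<phi> (- a) = - \<phi> a"
  using additive_minus[of \<phi>] phi_add by auto

lemma unit_cancel: "smul \<delta> x = smul \<delta> y \<Longrightarrow> x = y"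
proof -
  assume "smul \<delta> x = smul \<delta> y"
  then have "smul (\<sigma> \<gamma> * \<gamma>) (smul \<delta> x) = smul (\<sigma> \<gamma> * \<gamma>) (smul \<delta> y)" by simp
  then show ?thesis by (simp add: gamma_delta)
qed

lemma phi_sharp_phi: "\<phi> (sharp (\<phi> a)) = smul \<delta> (sharp a)"
proof -
  have "\<phi> (smul \<delta> (sharp a)) = \<phi> (\<phi> (sharp (\<phi> a)))" by (simp add: phi_smul sigma_delta phi_sharp)
  then show ?thesis using phi_inj by (simp add: inj_eq)
qed

lemma phi_cross_phi: "\<phi> (\<phi> a \<otimes> \<phi> b) = smul \<delta> (a \<otimes> b)"
  using phi_sharp_phi[of "a + b"]
  by (simp add: phi_add sharp_add phi_sharp_phi scale_right_distrib algebra_simps)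

text \<open>
  Let \<open>s\<close> be the difference of the two sides. Evaluating \<open>(\<phi> \<circ> \<sharp>)\<^sup>2\<close> at \<open>\<phi> a\<close> in
  two ways gives \<open>s \<phi>(a) = 0\<close>. Then \<open>s\<^sup>3\<close> annihilates \<open>N (\<phi> a)\<close> and \<open>\<sigma> (N a)\<close>, hence also \<open>s\<close>, and
  \<open>K\<close> is reduced.
\<close>

lemma N_phi: "N (\<phi> a) = \<delta> * \<sigma> (N a)"
proof -
  define s where "s = N (\<phi> a) - \<delta> * \<sigma> (N a)"
  have "smul \<delta> (smul (N (\<phi> a)) (\<phi> a)) = \<phi> (sharp (\<phi> (sharp (\<phi> a))))"
    by (simp only: phi_sharp_phi[of "sharp (\<phi> a)"] sharp_sharp)
  also have "\<dots> = smul \<delta> (smul (\<delta> * \<sigma> (N a)) (\<phi> a))"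
    by (simp add: phi_sharp_phi sharp_smul sharp_sharp phi_smul sigma_simps sigma_delta
        power2_eq_square mult_ac)
  finally have "smul (N (\<phi> a)) (\<phi> a) = smul (\<delta> * \<sigma> (N a)) (\<phi> a)"
    by (rule unit_cancel)
  then have s1: "smul s (\<phi> a) = 0" by (simp add: s_def scale_left_diff_distrib)
  then have "\<phi> (smul (\<sigma> s) a) = \<phi> 0" by (simp add: phi_smul sigma_sigma phi_0)
  then have s2: "smul (\<sigma> s) a = 0" using phi_inj by (simp add: inj_eq)
  have N0: "N 0 = 0" using N_smul[of 0 e] by simp
  have "s ^ 3 * N (\<phi> a) = 0" using N_smul[of s "\<phi> a"] s1 N0 by simp
  moreover have "\<sigma> s ^ 3 * N a = 0" using N_smul[of "\<sigma> s" a] s2 N0 by simp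
  then have "\<sigma> (\<sigma> s ^ 3 * N a) = 0" by (simp add: sigma_0)
  then have "s ^ 3 * \<sigma> (N a) = 0" by (simp add: sigma_simps power3_eq_cube)
  ultimately have "(s * s) * (s * s) = 0"
    using arg_cong[OF s_def, of "\<lambda>x. s ^ 3 * x"] by (simp add: algebra_simps power3_eq_cube)
  then have "s = 0" using reduced by blast
  then show ?thesis by (simp add: s_def)
qed

text \<open>
  The part of \<open>N_phi\<close> of bidegree \<open>(1, 2)\<close>, isolated by replacing \<open>a\<close> with \<open>- a\<close>.
\<close>

lemma T_phi_sharp: "T (\<phi> a) (sharp (\<phi> b)) = \<delta> * \<sigma> (T a (sharp b))"
proof -
  have 1: "T (\<phi> b) (sharp (\<phi> a)) + T (\<phi> a) (sharp (\<phi> b)) = \<delta> * \<sigma> (T b (sharp a)) + \<delta> * \<sigma> (T a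
      (sharp b))" for a b
    using N_phi[of "a + b"] by (simp add: phi_add N_add N_phi sigma_simps algebra_simps)
  have "sharp (- x) = sharp x" for x using sharp_smul[of "-1" x] by simp
  with 1[of "- a" b] have 2: "T (\<phi> b) (sharp (\<phi> a)) - T (\<phi> a) (sharp (\<phi> b)) = \<delta> * \<sigma> (T b (sharp
      a)) - \<delta> * \<sigma> (T a (sharp b))"
    by (simp add: phi_minus T_minus sigma_simps)
  let ?x = "T (\<phi> a) (sharp (\<phi> b)) - \<delta> * \<sigma> (T a (sharp b))"
  have "?x + ?x = (T (\<phi> b) (sharp (\<phi> a)) + T (\<phi> a) (sharp (\<phi> b))) - (T (\<phi> b) (sharp (\<phi> a)) - T (\<phi>
      a) (sharp (\<phi> b)))
      - (\<delta> * \<sigma> (T a (sharp b)) + \<delta> * \<sigma> (T a (sharp b)))" by (simp add: algebra_simps)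
  also have "\<dots> = 0" unfolding 1[of b a] 2 by (simp add: algebra_simps)
  finally have "?x = 0" by (rule two_three_cancel_K(1))
  then show ?thesis by simp
qed

text \<open>
  By \<open>T_phi_sharp\<close> the claim holds if \<open>b\<close> is an adjoint, and the adjoints span \<open>J\<close> because
  \<open>b = T(b, e) e - e \<times> b\<close>.
\<close>

lemma T_phi_commute: "T (\<phi> a) b = \<sigma> (T a (\<phi> b))"
proof -
  define good where "good b \<longleftrightarrow> (\<forall>a. T (\<phi> a) b = \<sigma> (T a (\<phi> b)))" for b
  have add: "good (b + c)" if "good b" "good c" for b c
    using that by (simp add: good_def T_add_right phi_add sigma_add)
  have smul: "good (smul r b)" if "good b" for r b
    using that by (simp add: good_def T_smul_right phi_smul sigma_simps)
  have sharp_phi: "good (sharp (\<phi> b))" for b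
    by (simp add: good_def T_phi_sharp phi_sharp_phi T_smul_right sigma_simps sigma_delta)
  have sharp: "good (sharp b)" for b using sharp_phi phi_surj by (metis surjD)
  have diff: "good (b - c)" if "good b" "good c" for b c
    using add[OF that(1) smul[OF that(2), of "-1"]] by simp
  have "good (e \<otimes> b)"
    using diff[OF diff[OF sharp[of "e + b"] sharp[of e]] sharp[of b]] by (simp add: cross_def)
  with smul[OF sharp[of e], of "t b"] have "good (smul (t b) e - e \<otimes> b)"
    unfolding sharp_unit by (rule diff)
  then have "good b" by (simp add: cross_e)
  then show ?thesis by (simp add: good_def)
qed

definition gamma_inv :: 'k where "gamma_inv = \<sigma> \<gamma> * \<delta>"

lemma gamma_gamma_inv: "\<gamma> * gamma_inv = 1"
  using gamma_delta by (simp add: gamma_inv_def mult_ac)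

lemma sigma_gamma_inv: "\<sigma> gamma_inv = \<gamma> * \<delta>"
  by (simp add: gamma_inv_def sigma_simps sigma_delta)

lemma gamma_phi_sharp: "\<phi> (smul \<gamma> (sharp (\<phi> a))) = smul gamma_inv (sharp a)"
  by (simp add: phi_smul phi_sharp_phi gamma_inv_def)

lemma gamma_phi_cross: "\<phi> (smul \<gamma> (\<phi> a \<otimes> \<phi> b)) = smul gamma_inv (a \<otimes> b)"
  by (simp add: phi_smul phi_cross_phi gamma_inv_def)

sublocale hermitian_cubic_norm_structure smul \<sigma> "\<lambda>b c. T b (\<phi> c)" "\<lambda>b c. smul \<gamma> (\<phi> b \<otimes> \<phi> c)"
  "\<lambda>b. smul \<gamma> (sharp (\<phi> b))" "\<lambda>b. gamma_inv * N b"
proof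
  fix a b c d :: 'j and r :: 'k
  show "a + a = 0 \<Longrightarrow> a = 0" "a + a + a = 0 \<Longrightarrow> a = 0" by (fact two_three_cancel_J)+
  show "T (a + b) (\<phi> c) = T a (\<phi> c) + T b (\<phi> c)" by (rule T_add_left)
  show "T (smul r a) (\<phi> b) = r * T a (\<phi> b)" by (rule T_smul_left)
  show "T b (\<phi> a) = \<sigma> (T a (\<phi> b))" by (simp add: T_phi_commute[symmetric] T_sym)
  show "smul \<gamma> (\<phi> a \<otimes> \<phi> b) = smul \<gamma> (\<phi> b \<otimes> \<phi> a)" by (simp only: cross_commute)
  show "smul \<gamma> (\<phi> a \<otimes> \<phi> (b + c)) = smul \<gamma> (\<phi> a \<otimes> \<phi> b) + smul \<gamma> (\<phi> a \<otimes> \<phi> c)"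
    by (simp add: phi_add cross_add_right scale_right_distrib)
  show "smul \<gamma> (\<phi> a \<otimes> \<phi> (smul r b)) = smul (\<sigma> r) (smul \<gamma> (\<phi> a \<otimes> \<phi> b))"
    by (simp add: phi_smul cross_smul_right mult_ac)
  show "T a (\<phi> (smul \<gamma> (\<phi> b \<otimes> \<phi> c))) = T b (\<phi> (smul \<gamma> (\<phi> a \<otimes> \<phi> c)))"
    by (simp add: gamma_phi_cross T_smul_right T_cross_left_commute[of a b])
  show "smul \<gamma> (\<phi> a \<otimes> \<phi> a) = smul \<gamma> (sharp (\<phi> a)) + smul \<gamma> (sharp (\<phi> a))"
    by (simp add: cross_self scale_right_distrib)
  show "T a (\<phi> (smul \<gamma> (sharp (\<phi> a)))) = gamma_inv * N a + gamma_inv * N a + gamma_inv * N a"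
    by (simp add: gamma_phi_sharp T_smul_right T_sharp_self algebra_simps)
  have gg: "\<gamma> * (gamma_inv * gamma_inv) = gamma_inv" "gamma_inv * \<gamma> = 1" using gamma_gamma_inv
      by (simp_all add: mult.assoc[symmetric] mult.commute)
  have "smul gamma_inv ((a \<otimes> d) \<otimes> (a \<otimes> c) + sharp a \<otimes> (d \<otimes> c)) =
    smul gamma_inv (smul (T d (sharp a)) c + smul (T c (a \<otimes> d)) a + smul (T c (sharp a)) d)"
    by (simp only: adjoint_linearized2)
  then show "smul \<gamma> (\<phi> (smul \<gamma> (\<phi> a \<otimes> \<phi> d)) \<otimes> \<phi> (smul \<gamma> (\<phi> a \<otimes> \<phi> c))) +
       smul \<gamma> (\<phi> (smul \<gamma> (sharp (\<phi> a))) \<otimes> \<phi> (smul \<gamma> (\<phi> d \<otimes> \<phi> c))) =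
       smul (T d (\<phi> (smul \<gamma> (sharp (\<phi> a))))) c + smul (T c (\<phi> (smul \<gamma> (\<phi> a \<otimes> \<phi> d)))) a +
       smul (T c (\<phi> (smul \<gamma> (sharp (\<phi> a))))) d"
    unfolding gamma_phi_cross gamma_phi_sharp
    by (simp add: bilinear_simps scale_right_distrib gg)
  have "smul \<gamma> (\<phi> d \<otimes> (sharp (\<phi> a) \<otimes> c) + \<phi> a \<otimes> ((\<phi> a \<otimes> \<phi> d) \<otimes> c)) =
    smul \<gamma> (smul (T (\<phi> d) (sharp (\<phi> a))) c + smul (T (\<phi> d) c) (sharp (\<phi> a)) + smul (T (\<phi> a) c) (\<phi>
        a \<otimes> \<phi> d))"
    by (simp only: cross_sharp_cross_linearized)
  then show "smul \<gamma> (\<phi> d \<otimes> \<phi> (smul \<gamma> (\<phi> (smul \<gamma> (sharp (\<phi> a))) \<otimes> \<phi> c))) +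
       smul \<gamma> (\<phi> a \<otimes> \<phi> (smul \<gamma> (\<phi> (smul \<gamma> (\<phi> a \<otimes> \<phi> d)) \<otimes> \<phi> c))) =
       smul (\<sigma> (T d (\<phi> (smul \<gamma> (sharp (\<phi> a)))))) c + smul (T c (\<phi> d)) (smul \<gamma> (sharp (\<phi> a))) +
       smul (T c (\<phi> a)) (smul \<gamma> (\<phi> a \<otimes> \<phi> d))"
    \<comment> \<open>only the outer products: the inner ones stay in the form \<open>\<phi> a\<close>, as on the other side\<close>
    unfolding gamma_phi_cross[of "smul \<gamma> (sharp (\<phi> a))" c]
        gamma_phi_cross[of "smul \<gamma> (\<phi> a \<otimes> \<phi> d)" c]
    by (simp add: gamma_phi_sharp bilinear_simps scale_right_distrib gamma_gamma_inv gg
        T_phi_sharp sigma_simps sigma_gamma_inv T_sym[of c] mult_ac)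
qed

end

context hermitian_cubic_norm_structure
begin

lemma h_add_right: "h c (a + b) = h c a + h c b" and h_smul_right: "h c (smul r a) = \<sigma> r * h c a"
  by (simp_all only: h_hermitian[of c] h_add_left h_smul_left sigma_add sigma_mult)

lemma circ_add_left: "(a + b) \<circ>\<^sub>J c = a \<circ>\<^sub>J c + b \<circ>\<^sub>J c"
    and circ_smul_left: "smul r a \<circ>\<^sub>J c = smul (\<sigma> r) (a \<circ>\<^sub>J c)"
  by (simp_all only: circ_commute[of _ c] circ_add_right circ_smul_right)

lemmas h_minus = additive_minus[of "\<lambda>a. h a c" for c, OF h_add_left]
    additive_minus[of "\<lambda>a. h c a" for c, OF h_add_right]
lemmas circ_minus = additive_minus[of "\<lambda>a. a \<circ>\<^sub>J c" for c, OF circ_add_left]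
    additive_minus[of "\<lambda>a. c \<circ>\<^sub>J a" for c, OF circ_add_right]

lemmas hermitian_simps = h_add_left h_add_right h_smul_left h_smul_right h_minus
  circ_add_left circ_add_right circ_smul_left circ_smul_right circ_minus sigma_simps

lemma circ_circ: "adj a \<circ>\<^sub>J (a \<circ>\<^sub>J c) = smul (n a) c + smul (h c (adj a)) a" (is "?l = ?r")
proof -
  have "?l + ?l + ?l = ?r + ?r + ?r"
    using circ_circ_linearized[of a a c]
    by (simp add: circ_self hermitian_simps h_adj_self scale_mult_numeral scale_left_distrib
        algebra_simps)
  then have "(?l - ?r) + (?l - ?r) + (?l - ?r) = 0" by (simp add: algebra_simps)
  from three_cancel[OF this] show ?thesis by simp
qed

lemma circ_adj: "a \<circ>\<^sub>J (adj a \<circ>\<^sub>J c) = smul (\<sigma> (n a)) c + smul (h c a) (adj a)" (is "?l = ?r")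
proof -
  have "?l + ?l + ?l = ?r + ?r + ?r"
    using circ_adj_linearized[of a a c]
    by (simp add: circ_self hermitian_simps h_adj_self scale_mult_numeral scale_left_distrib
        scale_right_distrib algebra_simps)
  then have "(?l - ?r) + (?l - ?r) + (?l - ?r) = 0" by (simp add: algebra_simps)
  from three_cancel[OF this] show ?thesis by simp
qed

lemma h_circ_circ_left: "h (a \<circ>\<^sub>J b) c = \<sigma> (h c (a \<circ>\<^sub>J b))"
  by (rule h_hermitian)

text \<open>
  The components \<open>A\<close> and \<open>B\<close> of \<open>S x x x = 6 \<epsilon> (A, B)\<close> for \<open>x = (s, b)\<close>, see \<open>S_diagonal\<close> below.
\<close>

definition cubic_K :: "'k \<Rightarrow> 'j \<Rightarrow> 'k" where
  "cubic_K s b = - s * s * \<sigma> s + s * h b b - 2 * \<sigma> (n b)"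

definition cubic_J :: "'k \<Rightarrow> 'j \<Rightarrow> 'j" where
  "cubic_J s b = smul (s * \<sigma> s - h b b) b - smul (2 * \<sigma> s) (adj b) + smul 2 (b \<circ>\<^sub>J adj b)"

lemma h_self: "\<sigma> (h b b) = h b b"
  by (simp only: h_hermitian[symmetric])

lemma cubic_relation1: "smul (cubic_K s b) b + smul s (cubic_J s b) + cubic_J s b \<circ>\<^sub>J b = 0"
proof -
  have 1: "b \<circ>\<^sub>J (b \<circ>\<^sub>J adj b) = smul (\<sigma> (n b)) b + smul (h b b) (adj b)"
    using circ_adj[of b b] by (simp only: circ_commute)
  show ?thesis
    unfolding circ_commute[of "cubic_J s b" b] unfolding cubic_K_def cubic_J_def
    by (simp add: hermitian_simps 1 h_self circ_self scale_right_distrib scale_right_diff_distrib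
        scale_left_distrib scale_left_diff_distrib scale_2 algebra_simps;
      simp add: numeral_to_front scale_mult_numeral scale_2 add_ac)
qed

lemma cubic_relation2:
  "h (cubic_J s b) b - h b (cubic_J s b) + 3 * (\<sigma> (cubic_K s b) * s - cubic_K s b * \<sigma> s) = 0"
proof -
  have 1: "h b (adj b) = 3 * n b" "h (adj b) b = 3 * \<sigma> (n b)"
    using h_hermitian[of "adj b" b] by (simp_all add: h_adj_self sigma_simps)
  have 2: "h b (b \<circ>\<^sub>J adj b) = 2 * h (adj b) (adj b)"
    by (subst circ_commute, subst h_circ) (simp add: circ_self h_add_right)
  then have 3: "h (b \<circ>\<^sub>J adj b) b = 2 * h (adj b) (adj b)"
    by (simp add: h_circ_circ_left sigma_simps h_self)
  show ?thesis
    unfolding cubic_K_def cubic_J_def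
    by (simp add: hermitian_simps 1 2 3 h_self algebra_simps)
qed

text \<open>
  The parts of \<open>cubic_J s b\<close> in \<open>b\<close> and \<open>adj b\<close> are covered by \<open>circ_circ\<close> and \<open>circ_adj\<close>. For the part
  in \<open>b \<circ> adj b\<close>, the linearized identities turn the two products that contain it into
  \<open>- adj b \<circ> (adj b \<circ> d)\<close> and scalar multiples of known elements; the former cancels.
\<close>

lemma cubic_relation3:
  "smul (\<sigma> (cubic_K s b) * s - cubic_K s b * \<sigma> s) d + smul (h d (cubic_J s b)) b + b \<circ>\<^sub>J (cubic_J
      s b \<circ>\<^sub>J d)
    = smul (h d b) (cubic_J s b) + cubic_J s b \<circ>\<^sub>J (b \<circ>\<^sub>J d)"
proof -
  have 1: "(b \<circ>\<^sub>J adj b) \<circ>\<^sub>J (b \<circ>\<^sub>J d) = smul (h d (adj b)) (adj b) + smul (h (adj b) (b \<circ>\<^sub>J d))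
      b + smul (h (adj b) (adj b)) d - adj b \<circ>\<^sub>J (adj b \<circ>\<^sub>J d)"
    using circ_circ_linearized[of b d "adj b"] circ_commute[of "b \<circ>\<^sub>J d" "b \<circ>\<^sub>J adj b"]
        circ_commute[of d "adj b"]
    by (simp add: algebra_simps)
  have 2: "b \<circ>\<^sub>J ((b \<circ>\<^sub>J adj b) \<circ>\<^sub>J d) = smul (h (adj b) (adj b)) d + smul (h d (adj b)) (adj b)
      + smul (h d b) (b \<circ>\<^sub>J adj b) - adj b \<circ>\<^sub>J (adj b \<circ>\<^sub>J d)"
    using circ_adj_linearized[of "adj b" b d]
    by (simp add: h_self algebra_simps)
  have 3: "h (adj b) (b \<circ>\<^sub>J d) = h d (b \<circ>\<^sub>J adj b)"
    using h_circ[of d "adj b" b] by (simp add: circ_commute)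
  have 4: "\<sigma> (cubic_K s b) * s - cubic_K s b * \<sigma> s = 2 * (\<sigma> s * \<sigma> (n b) - s * n b)"
    by (simp add: cubic_K_def sigma_simps h_self algebra_simps)
  show ?thesis
    unfolding 4 cubic_J_def
    by (simp add: hermitian_simps 1 2 3 circ_circ circ_adj h_self scale_2 scale_mult_numeral
     scale_right_distrib scale_right_diff_distrib scale_left_distrib scale_left_diff_distrib
         algebra_simps;
      simp add: numeral_to_front scale_mult_numeral scale_2 add_ac)
qed

end

section \<open>Freudenthal triple systems\<close>

text \<open>
  The last axiom is the quartic identity of Freudenthal triple systems: the operator \<open>D p x\<close> below
  vanishes for \<open>p = S x x x\<close>.
\<close>

locale freudenthal_triple_system = vector_space scale
  for scale :: "'f::field \<Rightarrow> 'a::ab_group_add \<Rightarrow> 'a" (infixr \<open>*s\<close> 75) +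
  fixes S :: "'a \<Rightarrow> 'a \<Rightarrow> 'a \<Rightarrow> 'a" and \<kappa> :: "'a \<Rightarrow> 'a \<Rightarrow> 'f"
  assumes two_nonzero: "(2::'f) \<noteq> 0" and three_nonzero: "(3::'f) \<noteq> 0"
    and S_add: "S (x + y) z w = S x z w + S y z w"
    and S_scale: "S (r *s x) z w = r *s S x z w"
    and S_swap12: "S x y z = S y x z" and S_swap23: "S x y z = S x z y"
    and \<kappa>_add: "\<kappa> (x + y) z = \<kappa> x z + \<kappa> y z" and \<kappa>_scale: "\<kappa> (r *s x) y = r * \<kappa> x y"
    and \<kappa>_skew: "\<kappa> x y = - \<kappa> y x"
    and \<kappa>_S: "\<kappa> (S x y z) w = \<kappa> (S x y w) z"
    and quartic: "S (S x x x) x y + \<kappa> x y *s S x x x + \<kappa> (S x x x) y *s x = 0"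
begin

lemma two_cancel: "(x::'a) + x = 0 \<Longrightarrow> x = 0" and three_cancel: "(x::'a) + x + x = 0 \<Longrightarrow> x = 0"
proof -
  have "(1::'f) + 1 \<noteq> 0" "(1::'f) + 1 + 1 \<noteq> 0" using two_nonzero three_nonzero by simp_all
  moreover have "x + x = (1 + 1) *s x" "x + x + x = (1 + 1 + 1) *s x"
    by (simp_all only: scale_left_distrib scale_one)
  ultimately show "x + x = 0 \<Longrightarrow> x = 0" "x + x + x = 0 \<Longrightarrow> x = 0" by (metis scale_eq_0_iff)+
qed

lemma S_add2: "S z (x + y) w = S z x w + S z y w" and S_scale2: "S z (r *s x) w = r *s S z x w"
  by (simp_all only: S_swap12[of z] S_add S_scale)

lemma S_add3: "S z w (x + y) = S z w x + S z w y" and S_scale3: "S z w (r *s x) = r *s S z w x"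
  by (simp_all only: S_swap23[of z w] S_add2 S_scale2)

lemma \<kappa>_add_right: "\<kappa> z (x + y) = \<kappa> z x + \<kappa> z y" and \<kappa>_scale_right: "\<kappa> v (r *s x) = r * \<kappa> v x"
  by (simp_all only: \<kappa>_skew[of z "x + y"] \<kappa>_skew[of z x] \<kappa>_skew[of z y] \<kappa>_skew[of v]
    \<kappa>_add \<kappa>_scale minus_add_distrib mult_minus_right)

lemmas S_minus = additive_minus[of "\<lambda>x. S x z w" for z w, OF S_add]
  additive_minus[of "\<lambda>x. S z x w" for z w, OF S_add2]
      additive_minus[of "\<lambda>x. S z w x" for z w, OF S_add3]

lemmas \<kappa>_minus = additive_minus[of "\<lambda>x. \<kappa> x z" for z, OF \<kappa>_add]
    additive_minus[of "\<lambda>x. \<kappa> z x" for z, OF \<kappa>_add_right]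

lemmas linear_simps = S_add S_add2 S_add3 S_scale S_scale2 S_scale3 \<kappa>_add \<kappa>_add_right \<kappa>_scale
    \<kappa>_scale_right
  S_minus \<kappa>_minus

text \<open>
  \<open>L x y\<close> splits into the derivation \<open>D x y\<close>, symmetric in \<open>x, y\<close>, and a scalar; in the algebra below,
  \<open>L x y\<close> is \<open>V x (2 \<epsilon> y)\<close>.
\<close>

definition D :: "'a \<Rightarrow> 'a \<Rightarrow> 'a \<Rightarrow> 'a" where
  "D x y z = S x y z + \<kappa> y z *s x + \<kappa> x z *s y"

definition L :: "'a \<Rightarrow> 'a \<Rightarrow> 'a \<Rightarrow> 'a" where
  "L x y z = D x y z + \<kappa> y x *s z"

lemma D_add1: "D (x + x') y z = D x y z + D x' y z"
    and D_add2: "D y (x + x') z = D y x z + D y x' z"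
  and D_add3: "D y z (x + x') = D y z x + D y z x'"
  by (simp_all add: D_def linear_simps scale_left_distrib scale_right_distrib algebra_simps)

lemma D_scale1: "D (r *s x) y z = r *s D x y z" and D_scale2: "D x (r *s y) z = r *s D x y z"
  and D_scale3: "D x y (r *s z) = r *s D x y z"
  by (simp_all add: D_def linear_simps scale_right_distrib algebra_simps)

lemma quartic_linearized:
  "D (S b c d) a y + D (S a c d) b y + D (S a b d) c y + D (S a b c) d y = 0"
proof -
  define M where "M a b c d = D (S b c d) a y + D (S a c d) b y + D (S a b d) c y + D (S a b c) d
      y" for a b c d
  have "M a b c d = 0"
  proof (rule polarize4[where M = M])
    show "M (a + a') b c d = M a b c d + M a' b c d" for a a' b c d
      by (simp add: M_def linear_simps D_add1 D_add2 algebra_simps)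
    show "M a b c d = M b a c d" for a b c d
      unfolding M_def S_swap12[of a b] by (simp add: algebra_simps)
    show "M a b c d = M a c b d" for a b c d
      unfolding M_def S_swap12[of b c] S_swap23[of a b c] by (simp add: algebra_simps)
    show "M a b c d = M a b d c" for a b c d
      unfolding M_def S_swap23[of _ c d] by (simp add: algebra_simps)
    show "M a a a a = 0" for a
      using quartic[of a y] by (simp add: M_def D_def algebra_simps)
  qed (erule two_cancel three_cancel)+
  then show ?thesis by (simp add: M_def)
qed

lemma \<kappa>_S_right: "\<kappa> w (S x y z) = - \<kappa> (S x y z) w"
  by (rule \<kappa>_skew)

lemma D_skew: "\<kappa> (D x y z) w + \<kappa> z (D x y w) = 0"
  by (simp add: D_def linear_simps \<kappa>_skew[of z "S x y w"] \<kappa>_S[of x y z w] \<kappa>_skew[of z y]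
      \<kappa>_skew[of z x])

text \<open>
  Write \<open>G w\<close> for the linearized quartic identity in five variables with \<open>w\<close> as the distinguished one.
  Twice the defect of the derivation rule is \<open>G a + G b - G y - G z - G u\<close>.
\<close>

lemma D_derivation_S: "D a b (S y z u) = S (D a b y) z u + S y (D a b z) u + S y z (D a b u)"
  (is "?l = ?r")
proof -
  have "(?l - ?r) + (?l - ?r) =
      (D (S z u a) y b + D (S y u a) z b + D (S y z a) u b + D (S y z u) a b)
    + (D (S z u b) y a + D (S y u b) z a + D (S y z b) u a + D (S y z u) b a)
    - (D (S b z u) a y + D (S a z u) b y + D (S a b u) z y + D (S a b z) u y)
    - (D (S b y u) a z + D (S a y u) b z + D (S a b u) y z + D (S a b y) u z)
    - (D (S b y z) a u + D (S a y z) b u + D (S a b z) y u + D (S a b y) z u)"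
    unfolding D_def linear_simps \<kappa>_S_right
    by (simp add: S_swap12 S_swap23 \<kappa>_S \<kappa>_skew[of b a] \<kappa>_skew[of y a] \<kappa>_skew[of y b]
      \<kappa>_skew[of z a] \<kappa>_skew[of z b] \<kappa>_skew[of z y] \<kappa>_skew[of u a] \<kappa>_skew[of u b] \<kappa>_skew[of u y]
          \<kappa>_skew[of u z]
      scale_left_distrib scale_right_distrib algebra_simps)
  also have "\<dots> = 0" by (simp only: quartic_linearized) simp
  finally have "(?l - ?r) + (?l - ?r) = 0" .
  from two_cancel[OF this] show ?thesis by simp
qed

text \<open>
  As \<open>D a b\<close> is skew for \<open>\<kappa>\<close>, it is also a derivation of the terms in \<open>\<kappa>\<close>, so of the triple product \<open>D\<close>.
\<close>

lemma D_derivation: "D a b (D x y z) = D (D a b x) y z + D x (D a b y) z + D x y (D a b z)"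
proof -
  have "\<kappa> y (D a b z) = - \<kappa> (D a b y) z" "\<kappa> x (D a b z) = - \<kappa> (D a b x) z"
    using D_skew[of a b y z] D_skew[of a b x z] by (simp_all add: eq_neg_iff_add_eq_0 add.commute)
  then show ?thesis
    unfolding D_def[of x y z] D_def[of "D a b x"] D_def[of x "D a b y"] D_def[of x y "D a b z"]
    by (simp add: D_add3 D_scale3 D_derivation_S algebra_simps)
qed

text \<open>
  The scalar parts of \<open>L\<close> are central; on the right-hand side they cancel because \<open>D x y\<close> is skew for \<open>\<kappa>\<close>.
\<close>

theorem L_commutator:
  "L x y (L z w u) - L z w (L x y u) = L (L x y z) w u + L z (D x y w - \<kappa> y x *s w) u"
proof -
  have "\<kappa> w (D x y z) = - \<kappa> (D x y w) z"
    using D_skew[of x y w z] by (simp add: eq_neg_iff_add_eq_0 add.commute)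
  then show ?thesis
    by (simp add: L_def D_derivation[of x y z w u] D_add1 D_add2 D_add3 D_scale1 D_scale2
        D_scale3 linear_simps
       additive_minus(3)[of "\<lambda>w. D z w u", OF D_add2]
      scale_right_distrib scale_left_distrib scale_left_diff_distrib algebra_simps)
qed

end

section \<open>The algebra \<open>K \<oplus> J\<close> of a hermitian cubic norm structure\<close>

text \<open>
  The skew unit \<open>\<epsilon>\<close> is fixed once and for all; it exists by \<open>ex_skew_unit\<close>.
\<close>

locale KJ_algebra = hermitian_cubic_norm_structure smul \<sigma> h circ adj n +
    quadratic_etale_extension \<iota> \<sigma>
  for smul :: "'k::comm_ring_1 \<Rightarrow> 'j::ab_group_add \<Rightarrow> 'j" and \<sigma> :: "'k \<Rightarrow> 'k"
    and h :: "'j \<Rightarrow> 'j \<Rightarrow> 'k" and circ :: "'j \<Rightarrow> 'j \<Rightarrow> 'j" (infixl \<open>\<circ>\<^sub>J\<close> 70) and adj n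
    and \<iota> :: "'f::field \<Rightarrow> 'k" +
  fixes \<epsilon> \<epsilon>' :: 'k
  assumes two_nonzero: "(2::'f) \<noteq> 0" and three_nonzero: "(3::'f) \<noteq> 0"
    and eps_unit: "\<epsilon> * \<epsilon>' = 1" and sigma_eps: "\<sigma> \<epsilon> = - \<epsilon>"
begin

abbreviation bar :: "'k \<times> 'j \<Rightarrow> 'k \<times> 'j" where "bar \<equiv> KJ_invol \<sigma>"

abbreviation scaleF :: "'f \<Rightarrow> 'k \<times> 'j \<Rightarrow> 'k \<times> 'j" where "scaleF \<equiv> KJ_scale \<iota> smul"

fun mul :: "'k \<times> 'j \<Rightarrow> 'k \<times> 'j \<Rightarrow> 'k \<times> 'j" where
  "mul (s, b) (t, c) = (s * t + h b c, smul s c + smul (\<sigma> t) b + b \<circ>\<^sub>J c)"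

fun scaleK :: "'k \<Rightarrow> 'k \<times> 'j \<Rightarrow> 'k \<times> 'j" where
  "scaleK r (s, b) = (r * s, smul r b)"

text \<open>\<open>(\<psi> x y, 0)\<close> is the skew element \<open>x \<cdot> bar y - y \<cdot> bar x\<close>.\<close>

fun \<psi> :: "'k \<times> 'j \<Rightarrow> 'k \<times> 'j \<Rightarrow> 'k" where
  "\<psi> (s, b) (t, c) = s * \<sigma> t - t * \<sigma> s + h b c - h c b"

fun S :: "'k \<times> 'j \<Rightarrow> 'k \<times> 'j \<Rightarrow> 'k \<times> 'j \<Rightarrow> 'k \<times> 'j" where
  "S (s, b) (t, c) (u, d) =
    (\<epsilon> * (s * (h c d + h d c) + t * (h b d + h d b) + u * (h b c + h c b)
       - 2 * (s * u * \<sigma> t + s * t * \<sigma> u + t * u * \<sigma> s) - 2 * \<sigma> (h b (c \<circ>\<^sub>J d))),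
     smul \<epsilon> (smul (t * \<sigma> u + u * \<sigma> t - h c d - h d c) b + smul (s * \<sigma> u + u * \<sigma> s - h b d - h d b) c
       + smul (s * \<sigma> t + t * \<sigma> s - h b c - h c b) d
       + smul 2 ((b \<circ>\<^sub>J c) \<circ>\<^sub>J d + (c \<circ>\<^sub>J d) \<circ>\<^sub>J b + (b \<circ>\<^sub>J d) \<circ>\<^sub>J c
          - smul (\<sigma> u) (b \<circ>\<^sub>J c) - smul (\<sigma> s) (c \<circ>\<^sub>J d) - smul (\<sigma> t) (b \<circ>\<^sub>J d))))"

abbreviation V where "V \<equiv> V_op mul bar"

lemma V_formula: "V (s, b) (t, c) (u, d) =
    (2 * s * u * \<sigma> t - u * t * \<sigma> s + s * h c d + t * h b d + u * h c b + \<sigma> (h b (c \<circ>\<^sub>J d)),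
     smul (h b c + t * \<sigma> s) d + smul (t * \<sigma> u + h d c) b + smul (s * \<sigma> u - h d b) c
      + smul (\<sigma> u) (b \<circ>\<^sub>J c) + smul (\<sigma> s) (c \<circ>\<^sub>J d) + smul (\<sigma> t) (b \<circ>\<^sub>J d)
      + (b \<circ>\<^sub>J c) \<circ>\<^sub>J d + (c \<circ>\<^sub>J d) \<circ>\<^sub>J b - (b \<circ>\<^sub>J d) \<circ>\<^sub>J c)"
  by (simp add: V_op_def KJ_invol_def hermitian_simps h_circ_circ_left h_circ[of d b]
      h_circ[of d c] h_circ[of c b]
    circ_commute[of c b] circ_commute[of d c] circ_commute[of d b]
    scale_right_distrib scale_right_diff_distrib scale_left_distrib scale_left_diff_distrib
        algebra_simps;
      simp add: numeral_to_front scale_mult_numeral scale_2 add_ac)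

text \<open>
  Multiplying \<open>y\<close> by a skew scalar changes the signs of the terms in which \<open>y\<close> occurs conjugated. After
  this change the terms that are trilinear on \<open>J\<close> are symmetric in \<open>x, y, z\<close>, and the sum of all others
  differs from its symmetrization by multiples of values of \<open>\<psi>\<close>.
\<close>

lemma V_eq_S: "V x (scaleK (2 * \<epsilon>) y) z =
    S x y z + scaleK (\<epsilon> * \<psi> y z) x + scaleK (\<epsilon> * \<psi> x z) y + scaleK (\<epsilon> * \<psi> y x) z"
proof -
  obtain s b t c u d where "x = (s, b)" "y = (t, c)" "z = (u, d)" by (metis surj_pair)
  then show ?thesis
    by (simp add: V_formula hermitian_simps sigma_eps scale_mult_numeral scale_2
    scale_right_distrib scale_right_diff_distrib scale_left_distrib scale_left_diff_distrib
        algebra_simps;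
      simp add: numeral_to_front scale_mult_numeral scale_2 add_ac)
qed

text \<open>
  In terms of \<open>L\<close> the last bracket is \<open>L x y w - 2 \<kappa>(y, x) w\<close>, that is, \<open>D x y w - \<kappa>(y, x) w\<close>.
\<close>

lemma V_eps_swap: "V (scaleK (2 * \<epsilon>) y) x (scaleK (2 * \<epsilon>) w) =
    - scaleK (2 * \<epsilon>) (V x (scaleK (2 * \<epsilon>) y) w - scaleK (2 * \<epsilon> * \<psi> y x) w)"
proof -
  obtain s b t c u d where "x = (s, b)" "y = (t, c)" "w = (u, d)" by (metis surj_pair)
  then show ?thesis
    by (simp add: V_formula hermitian_simps sigma_eps scale_mult_numeral scale_2
        circ_commute[of c b] h_circ[of c b]
    scale_right_distrib scale_right_diff_distrib scale_left_distrib scale_left_diff_distrib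
        algebra_simps;
      simp add: numeral_to_front scale_mult_numeral scale_2 add_ac)
qed

definition \<kappa> :: "'k \<times> 'j \<Rightarrow> 'k \<times> 'j \<Rightarrow> 'f" where
  "\<kappa> x y = (THE c. \<iota> c = \<epsilon> * \<psi> x y)"

lemma iota_\<kappa>: "\<iota> (\<kappa> x y) = \<epsilon> * \<psi> x y"
proof -
  have "\<sigma> (\<epsilon> * \<psi> x y) = \<epsilon> * \<psi> x y"
    by (cases x; cases y) (simp add: sigma_simps sigma_eps h_hermitian[symmetric] algebra_simps)
  then obtain c where c: "\<iota> c = \<epsilon> * \<psi> x y" using fixed_in_base by (metis rangeE)
  show ?thesis unfolding \<kappa>_def using c by (rule theI) (metis c iota_inj)
qed

lemma scaleF_eq: "scaleF r x = scaleK (\<iota> r) x"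
  by (cases x) (simp add: KJ_scale_def)

lemma vector_space_KJ: "vector_space scaleF"
  by unfold_locales
    (simp_all add: KJ_scale_def iota_add iota_mult iota_1 scale_right_distrib scale_left_distrib
        distrib_left distrib_right)

lemma \<psi>_add: "\<psi> (x + y) z = \<psi> x z + \<psi> y z" and \<psi>_skew: "\<psi> x y = - \<psi> y x"
  by (cases x; cases y; cases z; simp add: hermitian_simps algebra_simps)+

lemma \<psi>_scale: "\<sigma> r = r \<Longrightarrow> \<psi> (scaleK r x) y = r * \<psi> x y"
  by (cases x; cases y) (simp add: hermitian_simps algebra_simps)

lemma S_add: "S (x + y) z w = S x z w + S y z w"
  by (cases x; cases y; cases z; cases w)
    (simp add: hermitian_simps scale_right_distrib scale_left_distrib scale_right_diff_distrib
        scale_left_diff_distrib algebra_simps)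

lemma S_scale: "\<sigma> r = r \<Longrightarrow> S (scaleK r x) z w = scaleK r (S x z w)"
  by (cases x; cases z; cases w)
    (simp add: hermitian_simps scale_right_distrib scale_left_distrib scale_right_diff_distrib
        scale_left_diff_distrib algebra_simps)

lemma S_swap12: "S x y z = S y x z"
proof -
  obtain s b t c u d where e: "x = (s, b)" "y = (t, c)" "z = (u, d)" by (metis surj_pair)
  show ?thesis unfolding e by (simp add: circ_commute[of c b] h_circ[of c b] algebra_simps)
qed

lemma S_swap23: "S x y z = S x z y"
proof -
  obtain s b t c u d where e: "x = (s, b)" "y = (t, c)" "z = (u, d)" by (metis surj_pair)
  show ?thesis unfolding e by (simp add: circ_commute[of d c] algebra_simps)
qed

lemma h_circ_circ: "h f ((b \<circ>\<^sub>J c) \<circ>\<^sub>J d) = h (b \<circ>\<^sub>J c) (d \<circ>\<^sub>J f)"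
    "h ((b \<circ>\<^sub>J c) \<circ>\<^sub>J d) f = h (d \<circ>\<^sub>J f) (b \<circ>\<^sub>J c)"
proof -
  show "h f ((b \<circ>\<^sub>J c) \<circ>\<^sub>J d) = h (b \<circ>\<^sub>J c) (d \<circ>\<^sub>J f)"
    by (simp only: h_circ[of f] circ_commute[of f d])
  then show "h ((b \<circ>\<^sub>J c) \<circ>\<^sub>J d) f = h (d \<circ>\<^sub>J f) (b \<circ>\<^sub>J c)"
    by (simp only: h_hermitian[of _ f] h_hermitian[of "d \<circ>\<^sub>J f"])
qed

text \<open>
  As \<open>S\<close> has the skew factor \<open>\<epsilon>\<close>, both sides are multiples by \<open>\<epsilon>\<close> of sums of terms and their
  conjugates, and these sums are symmetric. For the
  terms with four arguments in \<open>J\<close> this holds by \<open>h_circ_circ\<close>.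
\<close>

lemma \<psi>_S: "\<psi> (S x y z) w = \<psi> (S x y w) z"
proof -
  obtain s b t c u d v f where e: "x = (s, b)" "y = (t, c)" "z = (u, d)" "w = (v, f)"
      by (metis surj_pair)
  show ?thesis unfolding e
    by (simp add: hermitian_simps sigma_eps h_circ_circ h_hermitian[of "b \<circ>\<^sub>J c" f]
        h_hermitian[of "c \<circ>\<^sub>J d" f]
     h_hermitian[of "b \<circ>\<^sub>J d" f] h_hermitian[of "b \<circ>\<^sub>J f" d] h_hermitian[of "c \<circ>\<^sub>J f" d]
         h_hermitian[of "b \<circ>\<^sub>J c" d] h_circ[of d b] h_circ[of d c] h_circ[of f b]
     h_circ[of f c] h_circ[of f d] h_circ[of c b] circ_commute[of c b] circ_commute[of d b]
         circ_commute[of d c]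
     circ_commute[of f b] circ_commute[of f c] circ_commute[of f d] h_hermitian[of c b]
         h_hermitian[of d b] h_hermitian[of d c]
     h_hermitian[of f b] h_hermitian[of f c] h_hermitian[of f d] algebra_simps)
qed

lemma S_diagonal: "S (s, b) (s, b) (s, b) = (6 * \<epsilon> * cubic_K s b, smul (6 * \<epsilon>) (cubic_J s b))"
proof -
  have "(b \<circ>\<^sub>J b) \<circ>\<^sub>J b = b \<circ>\<^sub>J adj b + b \<circ>\<^sub>J adj b"
    by (simp add: circ_self circ_add_left circ_commute[of "adj b" b])
  moreover have "h b (b \<circ>\<^sub>J b) = 6 * n b" by (simp add: circ_self h_add_right h_adj_self)
  ultimately show ?thesis
    by (simp add: cubic_K_def cubic_J_def hermitian_simps circ_self scale_2 scale_mult_numeral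
    scale_right_distrib scale_right_diff_distrib scale_left_distrib scale_left_diff_distrib
        algebra_simps;
      simp add: numeral_to_front scale_mult_numeral scale_2 add_ac)
qed

text \<open>
  Let \<open>y = (u, d)\<close>. In \<open>K\<close> the terms in \<open>d\<close> cancel by \<open>e1\<close> and those in \<open>u\<close> by \<open>e3\<close>; in \<open>J\<close> the terms in \<open>\<sigma> u\<close>
  cancel by \<open>e2\<close> and those in \<open>d\<close> by \<open>e2\<close>, \<open>e3\<close> and \<open>e4\<close>.
\<close>

lemma S_quartic:
  "S (S x x x) x y + scaleK (\<epsilon> * \<psi> x y) (S x x x) + scaleK (\<epsilon> * \<psi> (S x x x) y) x = 0"
proof -
  obtain s b u d where e: "x = (s, b)" "y = (u, d)" by (metis surj_pair)
  define A where "A = cubic_K s b"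
  define B where "B = cubic_J s b"
  define \<tau> where "\<tau> = 6 * \<epsilon>"
  have sigma_tau: "\<sigma> \<tau> = - \<tau>" by (simp add: \<tau>_def sigma_simps sigma_eps)
  have e2: "B \<circ>\<^sub>J b = - smul A b - smul s B"
    using cubic_relation1[of s b] unfolding A_def[symmetric] B_def[symmetric]
    by (simp add: algebra_simps eq_neg_iff_add_eq_0)
  have e1: "h B (b \<circ>\<^sub>J d) = - \<sigma> A * h d b - \<sigma> s * h d B"
  proof -
    have "h B (b \<circ>\<^sub>J d) = h d (B \<circ>\<^sub>J b)" by (simp only: circ_commute[of b d] h_circ[of B d])
    then show ?thesis by (simp add: e2 hermitian_simps)
  qed
  have e3: "h B b = h b B + 3 * (A * \<sigma> s - \<sigma> A * s)"
    using cubic_relation2[of s b] unfolding A_def[symmetric] B_def[symmetric]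
    by (simp add: algebra_simps)
  have e4: "b \<circ>\<^sub>J (B \<circ>\<^sub>J d) = smul (h d b) B + B \<circ>\<^sub>J (b \<circ>\<^sub>J d) + smul (A * \<sigma> s - \<sigma> A * s) d -
      smul (h d B) b"
    using cubic_relation3[of s b d] unfolding A_def[symmetric] B_def[symmetric]
    by (simp add: scale_left_diff_distrib algebra_simps)
  show ?thesis
    unfolding e S_diagonal A_def[symmetric] B_def[symmetric] \<tau>_def[symmetric]
    by (simp add: hermitian_simps sigma_eps sigma_tau e1 e2 e3 e4 circ_commute[of "b \<circ>\<^sub>J d" B]
        circ_commute[of "B \<circ>\<^sub>J d" b] zero_prod_def
       h_hermitian[symmetric] scale_2 scale_mult_numeral
    scale_right_distrib scale_right_diff_distrib scale_left_distrib scale_left_diff_distrib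
        algebra_simps;
      simp add: numeral_to_front scale_mult_numeral scale_2 add_ac)
qed

sublocale FTS: freudenthal_triple_system scaleF S \<kappa>
proof -
  have eqI: "a = b" if "\<iota> a = \<iota> b" for a b using that by (rule iota_inj)
  show "freudenthal_triple_system scaleF S \<kappa>"
  proof (intro freudenthal_triple_system.intro freudenthal_triple_system_axioms.intro
      vector_space_KJ)
    fix x y z w :: "'k \<times> 'j" and r
    show "(2::'f) \<noteq> 0" "(3::'f) \<noteq> 0" by (fact two_nonzero three_nonzero)+
    show "S (x + y) z w = S x z w + S y z w" by (rule S_add)
    show "S (scaleF r x) z w = scaleF r (S x z w)" unfolding scaleF_eq
        by (rule S_scale) (rule fixes_base)
    show "S x y z = S y x z" by (rule S_swap12)
    show "S x y z = S x z y" by (rule S_swap23)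
    show "\<kappa> (x + y) z = \<kappa> x z + \<kappa> y z"
      by (rule eqI) (simp add: iota_add iota_\<kappa> \<psi>_add algebra_simps)
    show "\<kappa> (scaleF r x) y = r * \<kappa> x y"
      by (rule eqI) (simp add: iota_mult iota_\<kappa> scaleF_eq \<psi>_scale fixes_base algebra_simps)
    show "\<kappa> x y = - \<kappa> y x"
      by (rule eqI) (simp add: iota_minus iota_\<kappa> \<psi>_skew[of x y])
    show "\<kappa> (S x y z) w = \<kappa> (S x y w) z"
      by (rule eqI) (simp only: iota_\<kappa> \<psi>_S[of x y z w])
    show "S (S x x x) x y + scaleF (\<kappa> x y) (S x x x) + scaleF (\<kappa> (S x x x) y) x = 0"
      unfolding scaleF_eq iota_\<kappa> by (rule S_quartic)
  qed
qed

lemma scaleK_scaleK: "scaleK r (scaleK q x) = scaleK (r * q) x" and scaleK_1: "scaleK 1 x = x"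
  by (cases x; simp)+

lemma scaleK_add: "scaleK (r + q) x = scaleK r x + scaleK q x"
  by (cases x) (simp add: scale_left_distrib algebra_simps)

lemma V_eq_L: "V x (scaleK (2 * \<epsilon>) y) z = FTS.L x y z"
  by (simp only: V_eq_S FTS.L_def FTS.D_def scaleF_eq iota_\<kappa>)

lemma V_minus: "V x (- y) z = - V x y z"
  by (cases x; cases y; cases z) (simp add: V_formula hermitian_simps algebra_simps)

lemma V_eps_D: "V (scaleK (2 * \<epsilon>) y) x (scaleK (2 * \<epsilon>) w) =
    - scaleK (2 * \<epsilon>) (FTS.D x y w - scaleF (\<kappa> y x) w)"
proof -
  have "scaleK (2 * \<epsilon> * \<psi> y x) w = scaleF (\<kappa> y x) w + scaleF (\<kappa> y x) w"
    unfolding scaleF_eq iota_\<kappa> by (simp add: scaleK_add[symmetric] mult.assoc)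
  then show ?thesis unfolding V_eps_swap V_eq_L by (simp add: FTS.L_def)
qed

lemma two_eps_unit: "\<exists>\<rho>. \<rho> * (2 * \<epsilon>) = 1"
proof
  have "\<iota> (inverse 2) * \<iota> 2 = 1" unfolding iota_mult[symmetric] using two_nonzero
      by (simp add: iota_1)
  moreover have "\<iota> 2 = 2" using iota_add[of 1 1] by (simp add: iota_1)
  ultimately have 1: "\<iota> (inverse 2) * 2 = 1" by simp
  have "(\<iota> (inverse 2) * \<epsilon>') * (2 * \<epsilon>) = (\<iota> (inverse 2) * 2) * (\<epsilon> * \<epsilon>')" by (simp only: mult_ac)
  then show "(\<iota> (inverse 2) * \<epsilon>') * (2 * \<epsilon>) = 1" unfolding 1 eps_unit by simp
qed

text \<open>
  Write \<open>y\<close> and \<open>w\<close> as multiples of \<open>2 \<epsilon>\<close> and apply \<open>L_commutator\<close>.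
\<close>

lemma V_commutator:
  "V x y (V z w u) - V z w (V x y u) = V (V x y z) w u - V z (V y x w) u"
proof -
  obtain \<rho> where "\<rho> * (2 * \<epsilon>) = 1" using two_eps_unit by blast
  then have inv: "scaleK (2 * \<epsilon>) (scaleK \<rho> x) = x" for x
    by (simp only: scaleK_scaleK mult.commute[of _ \<rho>] scaleK_1)
  define y' w' where "y' = scaleK \<rho> y" and "w' = scaleK \<rho> w"
  then have e: "y = scaleK (2 * \<epsilon>) y'" "w = scaleK (2 * \<epsilon>) w'" by (simp_all only: inv)
  show ?thesis
    unfolding e V_eps_D V_minus V_eq_L FTS.L_commutator by simp
qed

lemma mul_add_left: "mul (x + y) z = mul x z + mul y z"
    and mul_add_right: "mul z (x + y) = mul z x + mul z y"
  by (cases x; cases y; cases z; simp add: hermitian_simps scale_left_distrib scale_right_distrib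
      algebra_simps)+

lemma mul_scale_left: "mul (scaleF r x) y = scaleF r (mul x y)"
    and mul_scale_right: "mul y (scaleF r x) = scaleF r (mul y x)"
  by (cases x; cases y; simp add: KJ_scale_def hermitian_simps fixes_base scale_right_distrib
      algebra_simps)+

lemma structurable: "structurable_algebra scaleF mul (1, 0) bar"
proof -
  show ?thesis
  proof (intro structurable_algebra.intro structurable_algebra_axioms.intro vector_space_KJ)
    fix x y z w u :: "'k \<times> 'j"
    show "Vector_Spaces.linear scaleF scaleF (mul x)"
      by (simp add: Vector_Spaces.linear_iff vector_space_KJ mul_add_right mul_scale_right)
    show "Vector_Spaces.linear scaleF scaleF (\<lambda>x. mul x y)"
      by (simp add: Vector_Spaces.linear_iff vector_space_KJ mul_add_left mul_scale_left)
    show "mul (1, 0) x = x" "mul x (1, 0) = x"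
      by (cases x; simp add: hermitian_simps)+
    show "Vector_Spaces.linear scaleF scaleF bar"
      by (simp add: Vector_Spaces.linear_iff vector_space_KJ KJ_invol_def KJ_scale_def
          sigma_simps fixes_base)
    show "bar (bar x) = x" by (simp add: KJ_invol_def sigma_sigma)
    show "bar (mul x y) = mul (bar y) (bar x)"
      by (cases x; cases y) (simp add: KJ_invol_def sigma_simps h_hermitian[symmetric]
          circ_commute algebra_simps)
    show "V x y (V z w u) - V z w (V x y u) = V (V x y z) w u - V z (V y x w) u"
      by (rule V_commutator)
  qed
qed

lemma eps_cancel: "smul \<epsilon> b = 0 \<Longrightarrow> b = 0"
proof -
  assume "smul \<epsilon> b = 0"
  then have "smul (\<epsilon> * \<epsilon>') b = 0" by (simp add: mult.commute[of \<epsilon>] flip: scale_scale)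
  then show "b = 0" by (simp add: eps_unit)
qed

lemma sigma_eps': "\<sigma> \<epsilon>' = - \<epsilon>'"
proof -
  have "\<sigma> \<epsilon>' = \<sigma> \<epsilon>' * (\<epsilon> * \<epsilon>')" by (simp add: eps_unit)
  also have "\<dots> = - (\<sigma> (\<epsilon> * \<epsilon>')) * \<epsilon>'" by (simp add: sigma_simps sigma_eps)
  finally show ?thesis by (simp add: eps_unit sigma_1)
qed

lemma skew_dimension_1: "skew_dimension scaleF bar = 1"
proof -
  have "(\<epsilon>, 0) \<noteq> (0 :: 'k \<times> 'j)" using eps_unit by (auto simp: zero_prod_def)
  then have ind: "FTS.independent {(\<epsilon>, 0 :: 'j)}" by simp
  have sub: "{x. bar x = - x} \<subseteq> FTS.span {(\<epsilon>, 0)}"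
  proof
    fix x assume x: "x \<in> {x. bar x = - x}"
    obtain s b where e: "x = (s, b)" by (cases x)
    have "(\<sigma> s, b) = (- s, - b)" using x by (simp add: e KJ_invol_def)
    then have "b + b = 0" and s: "\<sigma> s = - s" by (simp_all add: eq_neg_iff_add_eq_0)
    from this(1) have b: "b = 0" by (rule two_cancel)
    have "\<sigma> (\<epsilon>' * s) = \<epsilon>' * s" by (simp add: sigma_simps sigma_eps' s)
    then obtain c where "\<epsilon>' * s = \<iota> c" using fixed_in_base by blast
    then have "\<iota> c * \<epsilon> = s" using eps_unit by (metis mult.assoc mult.commute mult_1)
    then have "x = scaleF c (\<epsilon>, 0)" by (simp add: e b KJ_scale_def)
    then show "x \<in> FTS.span {(\<epsilon>, 0)}" by (auto simp: FTS.span_singleton)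
  qed
  show ?thesis unfolding skew_dimension_def
    by (rule FTS.dim_unique[OF _ sub ind]) (auto simp: KJ_invol_def sigma_eps)
qed

text \<open>
  Left and right multiplication by \<open>(\<epsilon>, 0)\<close> differ by \<open>2 \<epsilon>\<close> on \<open>J\<close>.
\<close>

lemma center_eq: "central scaleF mul (1, 0) bar"
  unfolding central_def
proof (intro equalityI subsetI)
  fix x assume x: "x \<in> center mul bar"
  obtain s b where e: "x = (s, b)" by (cases x)
  have s: "\<sigma> s = s" and c: "commutator mul x (\<epsilon>, 0) = 0"
    using x e by (auto simp: center_def KJ_invol_def)
  from c have "smul \<epsilon> b + smul \<epsilon> b = 0"
    by (simp add: e commutator_def sigma_eps hermitian_simps zero_prod_def algebra_simps
        neg_eq_iff_add_eq_0)
  then have "b = 0" by (rule eps_cancel[OF two_cancel])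
  moreover obtain c where "s = \<iota> c" using fixed_in_base[OF s] by blast
  ultimately show "x \<in> range (\<lambda>c. scaleF c (1, 0))" by (auto simp: e KJ_scale_def)
next
  fix x :: "'k \<times> 'j" assume "x \<in> range (\<lambda>c. scaleF c (1, 0))"
  then obtain c where e: "x = (\<iota> c, 0)" by (auto simp: KJ_scale_def)
  have 1: "mul x y = scaleF c y" and 2: "mul y x = scaleF c y" for y
    unfolding e by (cases y; simp add: KJ_scale_def hermitian_simps fixes_base mult.commute)+
  have 3: "bar x = x" by (simp add: e KJ_invol_def fixes_base)
  show "x \<in> center mul bar"
    by (simp add: center_def commutator_def associator_def 1 2 3 mul_scale_left mul_scale_right)
qed

lemma simple:
  assumes nd: "\<And>b. b \<noteq> 0 \<Longrightarrow> \<exists>c. h b c \<noteq> 0"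
  shows "simple_algebra scaleF mul bar"
  unfolding simple_algebra_def
proof (intro allI impI)
  fix I assume I: "involution_ideal scaleF mul bar I"
  then have sub: "FTS.subspace I" and ml: "\<And>x y. x \<in> I \<Longrightarrow> mul x y \<in> I"
      and mr: "\<And>x y. x \<in> I \<Longrightarrow> mul y x \<in> I"
    and bar: "\<And>x. x \<in> I \<Longrightarrow> bar x \<in> I"
    by (auto simp: involution_ideal_def)
  obtain \<rho> where \<rho>: "\<rho> * (2 * \<epsilon>) = 1" using two_eps_unit by blast
  have add: "x + y \<in> I" if "x \<in> I" "y \<in> I" for x y using FTS.subspace_add[OF sub that] .
  have scK: "scaleK r x \<in> I" if "x \<in> I" for r x
    using mr[OF that, of "(r, 0)"] by (cases x) (simp add: hermitian_simps)
  \<comment> \<open>\<open>(\<epsilon>, 0)\<close> acts on \<open>J\<close> by \<open>\<epsilon>\<close> from the left and by \<open>- \<epsilon>\<close> from the right.\<close>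
  have K_part: "(s, 0) \<in> I" if "(s, b) \<in> I" for s b
  proof -
    have "scaleK \<epsilon> (s, b) + mul (s, b) (\<epsilon>, 0) \<in> I" using that by (intro add scK ml)
    then have "(2 * \<epsilon> * s, 0) \<in> I" by (simp add: hermitian_simps sigma_eps algebra_simps)
    moreover have "\<rho> * (2 * \<epsilon> * s) = s" using \<rho> by (simp only: mult.assoc[symmetric]) simp
    ultimately show ?thesis using scK[of "(2 * \<epsilon> * s, 0)" \<rho>] by simp
  qed
  have unit: "I = UNIV" if "(s, 0) \<in> I" and "s \<noteq> 0" for s
  proof -
    have fixed: "I = UNIV" if r: "(r, 0) \<in> I" "\<sigma> r = r" "r \<noteq> 0" for r
    proof -
      obtain c where c: "r = \<iota> c" using fixed_in_base[OF r(2)] by blast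
      then have "c \<noteq> 0" using r(3) iota_0 by auto
      then have "\<iota> (inverse c) * r = 1" unfolding c iota_mult[symmetric] by (simp add: iota_1)
      then have one: "(1, 0) \<in> I" using scK[OF r(1), of "\<iota> (inverse c)"] by simp
      have "x \<in> I" for x using ml[OF one, of x] by (cases x) (simp add: hermitian_simps)
      then show ?thesis by blast
    qed
    have tr: "I = UNIV" if r: "(r, 0) \<in> I" "r + \<sigma> r \<noteq> 0" for r
      using fixed[of "r + \<sigma> r"] add[OF r(1) bar[OF r(1)]] r(2)
          by (simp add: KJ_invol_def sigma_simps add.commute)
    \<comment> \<open>If the trace of \<open>s\<close> vanishes, then \<open>s\<close> is skew, and \<open>\<epsilon> s\<close> is fixed by \<open>\<sigma>\<close>.\<close>
    show ?thesis
    proof (cases "s + \<sigma> s = 0")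
      case True
      then have "\<sigma> s = - s" by (simp add: eq_neg_iff_add_eq_0 add.commute)
      moreover have "\<epsilon> * s + \<epsilon> * s \<noteq> 0"
      proof
        assume "\<epsilon> * s + \<epsilon> * s = 0"
        then have "\<rho> * (\<epsilon> * s + \<epsilon> * s) = 0" by simp
        then have "\<rho> * (2 * \<epsilon>) * s = 0" by (simp add: algebra_simps)
        then show False using \<open>s \<noteq> 0\<close> by (simp add: \<rho>)
      qed
      ultimately show ?thesis
        using tr[of "\<epsilon> * s"] scK[OF \<open>(s, 0) \<in> I\<close>, of \<epsilon>] by (simp add: sigma_simps sigma_eps)
    next
      case False
      then show ?thesis using tr that by blast
    qed
  qed
  show "I = {0} \<or> I = UNIV"
  proof (cases "I = {0}")
    case False
    then obtain s b where sb: "(s, b) \<in> I" "(s, b) \<noteq> 0" using FTS.subspace_0[OF sub]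
        by (metis singletonI surj_pair subsetI subset_antisym singletonD)
    show ?thesis
    proof (cases "s = 0")
      case False
      then show ?thesis using unit[OF K_part[OF sb(1)]] by blast
    next
      case True
      then have "b \<noteq> 0" using sb(2) by (auto simp: zero_prod_def)
      then obtain c where c: "h b c \<noteq> 0" using nd by blast
      have "(h b c, b \<circ>\<^sub>J c) \<in> I" using ml[OF sb(1), of "(0, c)"] True
          by (simp add: hermitian_simps)
      then show ?thesis using unit[OF K_part c] by blast
    qed
  qed simp
qed

end

section \<open>The structurable algebra of a self-adjoint autotopy\<close>

lemma mult_unit_inverse:
  assumes "x dvd 1"
  shows "x * unit_inverse x = 1"
proof -
  obtain y where y: "x * y = 1" using assms by (metis dvdE)
  have "z = y" if "x * z = 1" for z
    using that y by (metis mult.assoc mult.commute mult_1)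
  with y show ?thesis unfolding unit_inverse_def by (rule theI)
qed

theorem theorem3p4:
  fixes \<iota> :: "'f::field \<Rightarrow> 'k::comm_ring_1"
    and \<sigma> :: "'k \<Rightarrow> 'k"
    and smul :: "'k \<Rightarrow> 'j::ab_group_add \<Rightarrow> 'j"
    and N :: "'j \<Rightarrow> 'k"
    and sharp :: "'j \<Rightarrow> 'j"
    and T :: "'j \<Rightarrow> 'j \<Rightarrow> 'k"
    and e :: 'j
    and \<phi> :: "'j \<Rightarrow> 'j"
    and \<gamma> :: 'k
  assumes "CHAR('f) \<noteq> 2" and "CHAR('f) \<noteq> 3"
    and "quadratic_etale_extension \<iota> \<sigma>"
    and "cubic_norm_structure smul N sharp T e"
    and "\<phi> \<in> Str smul N sharp T e"
    and "semilinear smul \<sigma> \<phi>"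
    and "self_adjoint smul sharp T e \<phi>"
    and "\<sigma> \<gamma> * \<gamma> = unit_inverse (N (\<phi> e))"
  shows
    "N (\<phi> e) \<in> range \<iota> \<and>
     (quadratic_map smul sharp \<or> nondegenerate T \<longrightarrow>
        structurable_algebra (KJ_scale \<iota> smul) (KJ_mult smul sharp T \<sigma> \<phi> \<gamma>) (1, 0) (KJ_invol \<sigma>) \<and>
        skew_dimension (KJ_scale \<iota> smul) (KJ_invol \<sigma> :: 'k \<times> 'j \<Rightarrow> 'k \<times> 'j) = 1) \<and>
     (nondegenerate T \<longrightarrow>
        structurable_algebra (KJ_scale \<iota> smul) (KJ_mult smul sharp T \<sigma> \<phi> \<gamma>) (1, 0) (KJ_invol \<sigma>) \<and>
        central (KJ_scale \<iota> smul) (KJ_mult smul sharp T \<sigma> \<phi> \<gamma>) (1, 0) (KJ_invol \<sigma>) \<and>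
        simple_algebra (KJ_scale \<iota> smul) (KJ_mult smul sharp T \<sigma> \<phi> \<gamma>) (KJ_invol \<sigma>))"
proof -
  interpret K: quadratic_etale_extension \<iota> \<sigma> by fact
  interpret J: cubic_norm_structure smul N sharp T e by fact
  let ?\<delta> = "N (\<phi> e)"
  let ?A = "structurable_algebra (KJ_scale \<iota> smul) (KJ_mult smul sharp T \<sigma> \<phi> \<gamma>) (1, 0) (KJ_invol
      \<sigma>) \<and>
     skew_dimension (KJ_scale \<iota> smul) (KJ_invol \<sigma> :: 'k \<times> 'j \<Rightarrow> 'k \<times> 'j) = 1 \<and>
     central (KJ_scale \<iota> smul) (KJ_mult smul sharp T \<sigma> \<phi> \<gamma>) (1, 0) (KJ_invol \<sigma>) \<and>
     (nondegenerate T \<longrightarrow> simple_algebra (KJ_scale \<iota> smul) (KJ_mult smul sharp T \<sigma> \<phi> \<gamma>) (KJ_invol \<sigma>))"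
  have char: "(2::'f) \<noteq> 0" "(3::'f) \<noteq> 0"
    using CHAR_neq_prime_nonzero[of 2, where 'f = 'f] CHAR_neq_prime_nonzero[of 3, where 'f = 'f]
        assms(1,2) by auto
  have phi: "bij \<phi>" "invertible N (\<phi> e)"
    and phi_sharp: "\<phi> (sharp a) = isotope_sharp smul N sharp T (\<phi> e) (\<phi> a)" for a
    using assms(5) by (auto simp: Str_def)
  have delta: "?\<delta> * unit_inverse ?\<delta> = 1" using phi(2)
      by (intro mult_unit_inverse) (simp add: invertible_def)
  have "\<sigma> (\<sigma> \<gamma> * \<gamma>) = \<sigma> \<gamma> * \<gamma>" by (simp add: K.sigma_simps mult.commute)
  then have inv: "\<sigma> (unit_inverse ?\<delta>) = unit_inverse ?\<delta>" using assms(8) by simp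
  have "\<sigma> ?\<delta> = \<sigma> ?\<delta> * (?\<delta> * unit_inverse ?\<delta>)" by (simp add: delta)
  also have "\<dots> = \<sigma> (?\<delta> * unit_inverse ?\<delta>) * ?\<delta>" by (simp add: K.sigma_simps inv)
  finally have sigma_delta: "\<sigma> ?\<delta> = ?\<delta>" by (simp add: delta K.sigma_simps)
  have U: "U_op smul sharp T (\<phi> e) x = \<phi> (\<phi> x)" for x
  proof -
    have "(inv \<phi> \<circ> U_op smul sharp T (\<phi> e)) x = \<phi> x"
      using assms(7) by (simp add: self_adjoint_def adjoint_def)
    then show ?thesis using phi(1) by (metis bij_inv_eq_iff comp_apply)
  qed
  have A: ?A if "quadratic_map smul sharp"
  proof -
    have "(6::'f) = 2 * 3" by simp
    then have "(6::'f) \<noteq> 0" using char by (metis mult_eq_0_iff)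
    then have "\<iota> (6 * inverse 6) = 1" by (simp add: K.iota_1)
    moreover have "\<iota> 6 = 6"
    proof -
      have "(6::'f) = 1 + 1 + 1 + 1 + 1 + 1" by simp
      then show ?thesis by (simp only: K.iota_add K.iota_1) simp
    qed
    ultimately have six: "\<exists>i::'k. 6 * i = 1" by (metis K.iota_mult)
    interpret J: self_adjoint_autotopy smul N sharp T e \<sigma> \<phi> \<gamma> ?\<delta>
    proof
      show "quadratic_map smul sharp" by fact
      show "\<exists>i::'k. 6 * i = 1" by fact
      show "y * y = 0 \<Longrightarrow> y = 0" for y :: 'k by (rule K.reduced)
      show "semilinear smul \<sigma> \<phi>" by fact
      show "surj \<phi>" "inj \<phi>" using phi(1) by (rule bij_is_surj, rule bij_is_inj)
      show "smul ?\<delta> (\<phi> (sharp a)) = \<phi> (\<phi> (sharp (\<phi> a)))" for a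
        unfolding phi_sharp[of a] isotope_sharp_def U by (simp add: delta)
      show "\<sigma> \<gamma> * \<gamma> * ?\<delta> = 1" using delta assms(8) by (simp add: mult.commute)
    qed
    obtain \<epsilon> \<epsilon>' where eps: "\<epsilon> * \<epsilon>' = 1" "\<sigma> \<epsilon> = - \<epsilon>" using K.ex_skew_unit by blast
    interpret A: KJ_algebra smul \<sigma> "\<lambda>b c. T b (\<phi> c)" "\<lambda>b c. smul \<gamma> (cross sharp (\<phi> b) (\<phi> c))"
      "\<lambda>b. smul \<gamma> (sharp (\<phi> b))" "\<lambda>b. J.gamma_inv * N b" \<iota> \<epsilon> \<epsilon>'
      by standard (use char eps in auto)
    have "KJ_mult smul sharp T \<sigma> \<phi> \<gamma> x y = A.mul x y" for x y by (cases x; cases y) simp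
    then have mul: "KJ_mult smul sharp T \<sigma> \<phi> \<gamma> = A.mul" by (intro ext)
    have "\<exists>c. T b (\<phi> c) \<noteq> 0" if "nondegenerate T" "b \<noteq> 0" for b
      using that J.phi_surj unfolding nondegenerate_def by (metis surjD)
    then show ?thesis
      unfolding mul using A.structurable A.skew_dimension_1 A.center_eq A.simple by blast
  qed
  show ?thesis
    using K.fixed_in_base[OF sigma_delta] A J.nondegenerate_imp_quadratic_map by blast
qed

end
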